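(* Let $\varphi$ be a positive linear map on a unital $C^*$-algebra $\mathcal{A}$ and let $s>0$. The following are equivalent: (1) $r(\varphi)<s$; (2) there exists $w\ge0$ in $\mathcal{A}$ with $\varphi(w)=s(w-1)$; (3) there exists a strictly positive $v\in\mathcal{A}$ such that $\|\alpha_v^{-1}\circ\varphi\circ\alpha_v\|<s$; (4) there exists a positive map $\psi$ on $\mathcal{A}$ which is elementarily similar to $\varphi$ with $\|\psi\|<s$.
   Context: $r(\varphi)$ is the spectral radius of $\varphi$ as a bounded operator on $\mathcal{A}$, and $\|\cdot\|$ the operator norm. An element is strictly positive if it is positive and invertible. For $a\in\mathcal{A}$, $\alpha_a$ is the map $x\mapsto a^*xa$; for invertible $a$, $\alpha_a^{-1}$ denotes its inverse map $x\mapsto (a^* )^{-1}xa^{-1}$. A positive map $\varphi$ is elementarily similar to a positive map $\psi$ if there exists invertible $a\in\mathcal{A}$ with $\varphi=\alpha_a^{-1}\circ\psi\circ\alpha_a$. *)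

theory Defs
  imports "HOL-Analysis.Analysis"
begin

text \<open>A unital C*-algebra: a complex unital Banach algebra with involution satisfying
the C*-identity. Complex scalars are encoded by a central element ci with ci*ci = -1
(the element i*1), so complex scalar multiplication is (a + b i) x = (a 1 + b ci) x.\<close>

class cstar_algebra = real_normed_algebra_1 + banach +
  fixes cstar_adj :: "'a \<Rightarrow> 'a"
    and ci :: 'a
  assumes ci_sq: "ci * ci = - 1"
    and ci_central: "ci * x = x * ci"
    and adj_adj: "cstar_adj (cstar_adj x) = x"
    and adj_add: "cstar_adj (x + y) = cstar_adj x + cstar_adj y"
    and adj_scaleR: "cstar_adj (r *\<^sub>R x) = r *\<^sub>R cstar_adj x"
    and adj_ci: "cstar_adj ci = - ci"
    and adj_mult: "cstar_adj (x * y) = cstar_adj y * cstar_adj x"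
    and cstar_identity: "norm (cstar_adj x * x) = (norm x)\<^sup>2"

definition cscale :: "complex \<Rightarrow> 'a::cstar_algebra \<Rightarrow> 'a" where
  "cscale c x = (Re c *\<^sub>R 1 + Im c *\<^sub>R ci) * x"

definition cinvertible :: "'a::cstar_algebra \<Rightarrow> bool" where
  "cinvertible a \<longleftrightarrow> (\<exists>b. a * b = 1 \<and> b * a = 1)"

definition cinv :: "'a::cstar_algebra \<Rightarrow> 'a" where
  "cinv a = (THE b. a * b = 1 \<and> b * a = 1)"

definition elem_spectrum :: "'a::cstar_algebra \<Rightarrow> complex set" where
  "elem_spectrum x = {c. \<not> cinvertible (x - cscale c 1)}"

definition positive :: "'a::cstar_algebra \<Rightarrow> bool" where
  "positive x \<longleftrightarrow> cstar_adj x = x \<and> elem_spectrum x \<subseteq> {c. Im c = 0 \<and> 0 \<le> Re c}"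

definition strictly_positive :: "'a::cstar_algebra \<Rightarrow> bool" where
  "strictly_positive x \<longleftrightarrow> positive x \<and> cinvertible x"

definition clinear_map :: "('a::cstar_algebra \<Rightarrow> 'a) \<Rightarrow> bool" where
  "clinear_map f \<longleftrightarrow> (\<forall>x y. f (x + y) = f x + f y) \<and> (\<forall>c x. f (cscale c x) = cscale c (f x))"

definition positive_map :: "('a::cstar_algebra \<Rightarrow> 'a) \<Rightarrow> bool" where
  "positive_map f \<longleftrightarrow> clinear_map f \<and> (\<forall>x. positive x \<longrightarrow> positive (f x))"

definition op_spectrum :: "('a::cstar_algebra \<Rightarrow> 'a) \<Rightarrow> complex set" where
  "op_spectrum f = {c. \<not> bij (\<lambda>x. f x - cscale c x)}"

definition spectral_radius :: "('a::cstar_algebra \<Rightarrow> 'a) \<Rightarrow> real" where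
  "spectral_radius f = Sup (cmod ` op_spectrum f)"

definition alpha :: "'a::cstar_algebra \<Rightarrow> 'a \<Rightarrow> 'a" where
  "alpha a x = cstar_adj a * x * a"

definition alpha_inv :: "'a::cstar_algebra \<Rightarrow> 'a \<Rightarrow> 'a" where
  "alpha_inv a x = cstar_adj (cinv a) * x * cinv a"

definition elem_similar :: "('a::cstar_algebra \<Rightarrow> 'a) \<Rightarrow> ('a \<Rightarrow> 'a) \<Rightarrow> bool" where
  "elem_similar \<phi> \<psi> \<longleftrightarrow> (\<exists>a. cinvertible a \<and> \<phi> = alpha_inv a \<circ> \<psi> \<circ> alpha a)"

end

theory Submission
  imports Defs
begin

text \<open>Suppose \<open>w \<ge> 0\<close> and \<open>\<phi>(w) = s (w - 1)\<close>, and put \<open>y = w / s\<close>, so that \<open>y \<ge> 0\<close> solves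
\<open>s y - \<phi>(y) = 1\<close>. Conjugating by \<open>v = y\<^sup>1\<^sup>/\<^sup>2\<close> turns \<open>\<phi>\<close> into a positive map \<open>\<psi>\<close> with
\<open>0 \<le> \<psi>(1) = s - y\<^sup>-\<^sup>1 \<le> s - 1 / \<parallel>y\<parallel>\<close>, and \<open>\<parallel>\<psi>\<parallel> = \<parallel>\<psi>(1)\<parallel>\<close> by the Russo-Dye theorem. The latter rests on a
discrete Poisson formula, which approximates \<open>a\<close> with \<open>\<parallel>a\<parallel> < 1\<close> by combinations of positive
elements of sum close to \<open>1\<close> with unimodular coefficients. Similar maps have the same spectrum, so
\<open>r(\<phi>) \<le> \<parallel>\<psi>\<parallel> < s\<close>.

Conversely, suppose every real \<open>r \<ge> s\<close> lies outside the spectrum of \<open>\<phi>\<close>. The set of such \<open>r\<close> for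
which \<open>r y - \<phi>(y) = 1\<close> has a solution \<open>y \<ge> 0\<close> contains all large \<open>r\<close>. It is open to the left,
because by the first part \<open>\<phi>\<close> is similar to a positive map of norm less than \<open>r\<close>, and it is
closed, because the solution \<open>y\<close> at \<open>\<mu>\<close> satisfies \<open>r y - \<phi>(y) = 1 + (r - \<mu>) y \<ge> 0\<close> for \<open>r\<close> close
to \<open>\<mu>\<close>. Hence it reaches \<open>s\<close>. The same descent to \<open>0\<close> shows that the spectrum of \<open>\<phi>\<close> is not
empty, so the supremum defining the spectral radius is not a junk value.

Positivity of an element is handled through \<open>\<exists>t. \<parallel>t - a\<parallel> \<le> t\<close>, which for self-adjoint \<open>a\<close>
characterises squares of self-adjoint elements and is visibly closed under sums and limits.\<close>

section \<open>Adjoints and complex scalars\<close>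

abbreviation self_adj :: "'a::cstar_algebra \<Rightarrow> bool" where
  "self_adj x \<equiv> cstar_adj x = x"

abbreviation scal :: "complex \<Rightarrow> 'a::cstar_algebra" where
  "scal c \<equiv> cscale c 1"

lemma norm_adj [simp]: "norm (cstar_adj x) = norm (x::'a::cstar_algebra)"
proof -
  have norm_le: "norm y \<le> norm (cstar_adj y)" for y :: 'a
  proof (cases "y = 0")
    case False
    have "norm y * norm y \<le> norm (cstar_adj y) * norm y"
      using norm_mult_ineq[of "cstar_adj y" y] by (simp add: cstar_identity power2_eq_square)
    with False show ?thesis by simp
  qed simp
  from norm_le[of x] norm_le[of "cstar_adj x"] show ?thesis by (simp add: adj_adj)
qed

lemma bounded_linear_adj: "bounded_linear (cstar_adj :: 'a::cstar_algebra \<Rightarrow> 'a)"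
  by (rule bounded_linear_intro[where K = 1]) (auto simp: adj_add adj_scaleR)

lemmas adj_zero [simp] = linear_0[OF bounded_linear.linear[OF bounded_linear_adj]]
  and adj_minus = linear_neg[OF bounded_linear.linear[OF bounded_linear_adj]]
  and adj_diff = linear_diff[OF bounded_linear.linear[OF bounded_linear_adj]]
  and adj_sum = linear_sum[OF bounded_linear.linear[OF bounded_linear_adj]]
  and tendsto_adj = bounded_linear.tendsto[OF bounded_linear_adj]

lemmas adj_simps = adj_add adj_diff adj_minus adj_scaleR adj_mult adj_adj

lemma adj_one [simp]: "cstar_adj (1::'a::cstar_algebra) = 1"
  by (metis adj_adj adj_mult mult.right_neutral)

lemma norm_self_adj_square: "self_adj x \<Longrightarrow> norm (x * x) = (norm (x::'a::cstar_algebra))\<^sup>2"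
  by (metis cstar_identity)

lemma self_adj_cube_eq_0:
  fixes x :: "'a::cstar_algebra"
  assumes "self_adj x" "x * (x * x) = 0"
  shows "x = 0"
proof -
  have "norm ((x * x) * (x * x)) = 0" using assms(2) by (simp add: mult.assoc)
  then have "norm (x * x) = 0"
    using norm_self_adj_square[of "x * x"] assms(1) by (simp add: adj_mult)
  then show ?thesis using norm_self_adj_square[OF assms(1)] by simp
qed

lemma cscale_eq_scal_mult: "cscale c x = scal c * (x::'a::cstar_algebra)"
  by (simp add: cscale_def)

lemma cscale_of_real: "cscale (of_real r) x = r *\<^sub>R (x::'a::cstar_algebra)"
  by (simp add: cscale_def)

lemma scal_ii: "scal \<i> = (ci::'a::cstar_algebra)"
  by (simp add: cscale_def)

lemma scal_zero [simp]: "scal 0 = (0::'a::cstar_algebra)"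
  by (simp add: cscale_def)

lemma scal_one [simp]: "scal 1 = (1::'a::cstar_algebra)"
  by (simp add: cscale_def)

lemma scal_minus: "scal (- c) = - (scal c :: 'a::cstar_algebra)"
  by (simp add: cscale_def)

lemma scal_add: "scal (c + d) = scal c + (scal d :: 'a::cstar_algebra)"
  by (simp add: cscale_def algebra_simps)

lemma scal_sum: "scal (sum f A) = (\<Sum>i\<in>A. scal (f i) :: 'a::cstar_algebra)"
  by (induction A rule: infinite_finite_induct) (auto simp: scal_add)

lemma scal_mult: "scal (c * d) = scal c * (scal d :: 'a::cstar_algebra)"
  by (simp add: cscale_def algebra_simps ci_sq)

lemma scal_central: "x * scal c = scal c * (x::'a::cstar_algebra)"
  by (simp add: cscale_def algebra_simps ci_central)

lemma scal_left_commute: "x * (scal c * y) = scal c * (x * (y::'a::cstar_algebra))"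
  by (metis mult.assoc scal_central)

lemma scal_mult_power: "(scal c * x) ^ n = scal (c ^ n) * (x::'a::cstar_algebra) ^ n"
  by (induction n) (simp_all add: scal_mult mult.assoc scal_left_commute[of x])

lemma adj_scal: "cstar_adj (scal c) = (scal (cnj c) :: 'a::cstar_algebra)"
  by (simp add: cscale_def adj_simps adj_ci)

lemma adj_scal_mult: "cstar_adj (scal c * x) = scal (cnj c) * cstar_adj (x::'a::cstar_algebra)"
  by (simp add: adj_mult adj_scal scal_central)

lemma scal_cnj_mult_scal: "scal (cnj c) * scal c = (cmod c)\<^sup>2 *\<^sub>R (1::'a::cstar_algebra)"
  by (metis complex_norm_square cscale_of_real mult.commute scal_mult)

lemma norm_scal_mult [simp]: "norm (scal c * x) = cmod c * norm (x::'a::cstar_algebra)"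
proof -
  have "cstar_adj (scal c * x) * (scal c * x) = scal (cnj c) * scal c * (cstar_adj x * x)"
    by (simp add: adj_scal_mult mult.assoc scal_left_commute[of "cstar_adj x"])
  then have "(norm (scal c * x))\<^sup>2 = (cmod c * norm x)\<^sup>2"
    by (simp add: scal_cnj_mult_scal power_mult_distrib flip: cstar_identity)
  then show ?thesis by (simp add: power2_eq_iff_nonneg)
qed

lemma norm_ci_mult [simp]: "norm (ci * x) = norm (x::'a::cstar_algebra)"
  by (simp flip: scal_ii)

section \<open>The Cartesian decomposition\<close>

definition re_part :: "'a::cstar_algebra \<Rightarrow> 'a" where
  "re_part x = (1/2) *\<^sub>R (x + cstar_adj x)"

definition im_part :: "'a::cstar_algebra \<Rightarrow> 'a" where
  "im_part x = (1/2) *\<^sub>R (ci * (cstar_adj x - x))"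

lemma self_adj_re_part [simp]: "self_adj (re_part x)"
  by (simp add: re_part_def adj_simps add.commute)

lemma self_adj_im_part [simp]: "self_adj (im_part x)"
  by (simp add: im_part_def adj_simps adj_ci ci_central algebra_simps)

lemma ci_mult_ci_mult: "ci * (ci * x) = - (x::'a::cstar_algebra)"
  by (simp add: ci_sq flip: mult.assoc)

lemma re_part_add_im_part: "re_part x + ci * im_part x = x"
proof -
  have "re_part x + ci * im_part x = (1/2) *\<^sub>R ((x + cstar_adj x) + (x - cstar_adj x))"
    by (simp add: re_part_def im_part_def ci_mult_ci_mult flip: scaleR_add_right)
  then show ?thesis by (simp flip: scaleR_2)
qed

lemma adj_add_ci_mult:
  assumes "self_adj y" "self_adj k"
  shows "cstar_adj (y + ci * k) = y - ci * k"
  using assms by (simp add: adj_simps adj_ci ci_central)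

lemma re_part_add_ci_mult:
  assumes "self_adj y" "self_adj k"
  shows "re_part (y + ci * k) = y"
  by (simp add: re_part_def adj_add_ci_mult[OF assms] flip: scaleR_2)

lemma im_part_add_ci_mult:
  assumes "self_adj y" "self_adj k"
  shows "im_part (y + ci * k) = k"
proof -
  have "im_part (y + ci * k) = - (ci * (ci * k))"
    by (simp add: im_part_def adj_add_ci_mult[OF assms] algebra_simps flip: scaleR_2)
  then show ?thesis by (simp add: ci_mult_ci_mult)
qed

lemma norm_re_part_le: "norm (re_part x) \<le> norm x"
  using norm_triangle_ineq[of x "cstar_adj x"] by (simp add: re_part_def)

lemma norm_im_part_le: "norm (im_part x) \<le> norm x"
  using norm_triangle_ineq4[of "cstar_adj x" x] by (simp add: im_part_def)

lemma adj_mult_add_ci_mult: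
  fixes y k :: "'a::cstar_algebra"
  assumes "self_adj y" "self_adj k"
  shows "cstar_adj (y + ci * k) * (y + ci * k) = (y * y + k * k) + ci * (y * k - k * y)"
    and "(y + ci * k) * cstar_adj (y + ci * k) = (y * y + k * k) - ci * (y * k - k * y)"
proof -
  have left_commute: "x * (ci * z) = ci * (x * z)" for x z :: 'a
    by (metis ci_central mult.assoc)
  show "cstar_adj (y + ci * k) * (y + ci * k) = (y * y + k * k) + ci * (y * k - k * y)"
    "(y + ci * k) * cstar_adj (y + ci * k) = (y * y + k * k) - ci * (y * k - k * y)"
    unfolding adj_add_ci_mult[OF assms]
    by (simp_all add: left_diff_distrib right_diff_distrib distrib_left distrib_right mult.assoc
        left_commute[of y] left_commute[of k] ci_mult_ci_mult)
qed

lemma adj_mult_add_mult_adj: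
  "cstar_adj x * x + x * cstar_adj x
    = 2 *\<^sub>R (re_part x * re_part x + im_part x * im_part x)"
  using adj_mult_add_ci_mult[of "re_part x" "im_part x"]
  by (simp add: re_part_add_im_part scaleR_2)

text \<open>For commuting \<open>y\<close> and \<open>k\<close>, the element \<open>y + i k\<close> is \<open>T\<close> times a unitary.\<close>

lemma norm_le_of_sum_squares:
  fixes y k :: "'a::cstar_algebra"
  assumes self_adj: "self_adj y" "self_adj k" and comm: "y * k = k * y"
    and sum: "y * y + k * k = T\<^sup>2 *\<^sub>R 1" and T: "T \<ge> 0"
  shows "norm y \<le> T" "norm k \<le> T"
proof -
  have "(norm (y + ci * k))\<^sup>2 = T\<^sup>2"
    using adj_mult_add_ci_mult(1)[OF self_adj] comm sum by (simp flip: cstar_identity)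
  then have "norm (y + ci * k) = T" using T by (simp add: power2_eq_iff_nonneg)
  then show "norm y \<le> T" "norm k \<le> T"
    using norm_re_part_le[of "y + ci * k"] norm_im_part_le[of "y + ci * k"]
    by (simp_all add: re_part_add_ci_mult im_part_add_ci_mult self_adj)
qed

section \<open>Inverses\<close>

lemma cinv_unique:
  assumes "a * b = (1::'a::cstar_algebra)" "b * a = 1"
  shows "cinv a = b"
  unfolding cinv_def
proof (rule the_equality)
  fix c assume "a * c = 1 \<and> c * a = 1"
  then show "c = b" by (metis assms(2) mult.assoc mult.left_neutral mult.right_neutral)
qed (use assms in auto)

lemma cinv_inverse:
  assumes "cinvertible (a::'a::cstar_algebra)"
  shows "a * cinv a = 1" "cinv a * a = 1"
  using assms cinv_unique unfolding cinvertible_def by metis+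

lemma cinvertibleI: "a * b = 1 \<Longrightarrow> c * a = 1 \<Longrightarrow> cinvertible (a::'a::cstar_algebra)"
  unfolding cinvertible_def by (metis mult.assoc mult.left_neutral mult.right_neutral)

lemma cinvertible_cinv:
  assumes "cinvertible a"
  shows "cinvertible (cinv a)" "cinv (cinv a) = a"
  using cinv_inverse[OF assms] cinv_unique cinvertibleI by metis+

lemma cinvertible_scaleR:
  assumes "cinvertible (a::'a::cstar_algebra)" "r \<noteq> 0"
  shows "cinvertible (r *\<^sub>R a)"
  by (rule cinvertibleI[of _ "(1/r) *\<^sub>R cinv a" "(1/r) *\<^sub>R cinv a"])
    (use assms cinv_inverse in auto)

lemma cinvertible_scaleR_iff:
  "r \<noteq> 0 \<Longrightarrow> cinvertible (r *\<^sub>R a) \<longleftrightarrow> cinvertible (a::'a::cstar_algebra)"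
  using cinvertible_scaleR[of a r] cinvertible_scaleR[of "r *\<^sub>R a" "1/r"] by auto

lemma cinvertible_of_commuting_mult:
  fixes a b :: "'a::cstar_algebra"
  assumes "cinvertible (a * b)" "a * b = b * a"
  shows "cinvertible a"
proof (rule cinvertibleI)
  show "a * (b * cinv (a * b)) = 1" using cinv_inverse(1)[OF assms(1)] by (simp add: mult.assoc)
  show "(cinv (a * b) * b) * a = 1"
    using cinv_inverse(2)[OF assms(1)] assms(2) by (simp add: mult.assoc)
qed

lemma self_adj_cinv:
  assumes "cinvertible (a::'a::cstar_algebra)" "self_adj a"
  shows "self_adj (cinv a)"
  using cinv_unique[of a "cstar_adj (cinv a)"] cinv_inverse[OF assms(1)] assms(2)
  by (metis adj_mult adj_one)

text \<open>Jacobson's lemma: \<open>(1 - y x)\<^sup>-\<^sup>1 = 1 + y (1 - x y)\<^sup>-\<^sup>1 x\<close>.\<close>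

lemma cinvertible_one_minus_mult_swap:
  fixes x y :: "'a::cstar_algebra"
  assumes "cinvertible (1 - x * y)"
  shows "cinvertible (1 - y * x)"
proof (rule cinvertibleI)
  define g where "g = cinv (1 - x * y)"
  have g: "x * (y * g) = g - 1" "g * (x * y) = g - 1"
    using cinv_inverse[OF assms] by (simp_all add: g_def algebra_simps)
  have "y * (x * (y * (g * x))) = y * (x * (y * g) * x)" by (simp add: mult.assoc)
  also have "\<dots> = y * (g * x) - y * x" unfolding g by (simp add: algebra_simps)
  finally show "(1 - y * x) * (1 + y * (g * x)) = 1" by (simp add: algebra_simps)
  have "y * (g * (x * (y * x))) = y * (g * (x * y) * x)" by (simp add: mult.assoc)
  also have "\<dots> = y * (g * x) - y * x" unfolding g by (simp add: algebra_simps)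
  finally show "(1 + y * (g * x)) * (1 - y * x) = 1" by (simp add: algebra_simps)
qed

lemma one_minus_mult_sum_powers:
  fixes x :: "'a::ring_1"
  shows "(1 - x) * (\<Sum>i<n. x ^ i) = 1 - x ^ n" "(\<Sum>i<n. x ^ i) * (1 - x) = 1 - x ^ n"
proof -
  show left: "(1 - x) * (\<Sum>i<n. x ^ i) = 1 - x ^ n"
    by (induction n) (simp_all add: distrib_left left_diff_distrib)
  have "(\<Sum>i<n. x ^ i) * (1 - x) = (1 - x) * (\<Sum>i<n. x ^ i)"
    by (simp add: left_diff_distrib right_diff_distrib sum_distrib_left sum_distrib_right
        power_commutes sum_subtractf)
  with left show "(\<Sum>i<n. x ^ i) * (1 - x) = 1 - x ^ n" by simp
qed

lemma one_minus_mult_suminf_powers: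
  fixes x :: "'a::{real_normed_algebra_1, banach}"
  assumes "norm x < 1"
  shows "(1 - x) * (\<Sum>n. x ^ n) = 1" "(\<Sum>n. x ^ n) * (1 - x) = 1"
proof -
  have summable: "summable (\<lambda>n. x ^ n)" by (rule complete_algebra_summable_geometric[OF assms])
  have "(\<lambda>n. 1 - x ^ n) \<longlonglongrightarrow> 1 - 0"
    by (intro tendsto_intros summable_LIMSEQ_zero summable)
  moreover have "(\<lambda>n. (1 - x) * (\<Sum>i<n. x ^ i)) \<longlonglongrightarrow> (1 - x) * (\<Sum>n. x ^ n)"
    "(\<lambda>n. (\<Sum>i<n. x ^ i) * (1 - x)) \<longlonglongrightarrow> (\<Sum>n. x ^ n) * (1 - x)"
    by (intro tendsto_intros summable_LIMSEQ summable)+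
  ultimately show "(1 - x) * (\<Sum>n. x ^ n) = 1" "(\<Sum>n. x ^ n) * (1 - x) = 1"
    unfolding one_minus_mult_sum_powers by (auto intro: LIMSEQ_unique)
qed

lemma cinvertible_one_minus:
  assumes "norm (x::'a::cstar_algebra) < 1"
  shows "cinvertible (1 - x)"
  using one_minus_mult_suminf_powers[OF assms] by (rule cinvertibleI)

lemma cinvertible_near_scalar:
  fixes x :: "'a::cstar_algebra"
  assumes "norm (t *\<^sub>R 1 - x) < t"
  shows "cinvertible x"
proof -
  have t: "t > 0" using assms norm_ge_zero[of "t *\<^sub>R 1 - x"] by linarith
  then have "cinvertible (1 - (1/t) *\<^sub>R (t *\<^sub>R 1 - x))"
    using assms by (intro cinvertible_one_minus) simp
  then show ?thesis using t by (simp add: scaleR_diff_right cinvertible_scaleR_iff)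
qed

lemma cinv_one_minus_eq_sum:
  fixes b :: "'a::cstar_algebra"
  assumes b: "norm b < 1" and n: "n > 0"
  shows "cinv (1 - b) = cinv (1 - b ^ n) * (\<Sum>i<n. b ^ i)"
proof -
  have "norm (b ^ n) < 1"
    using norm_power_ineq[of b n] power_less_one_iff[of "norm b" n] b n by simp
  then have cinvertible: "cinvertible (1 - b)" "cinvertible (1 - b ^ n)"
    using b by (simp_all add: cinvertible_one_minus)
  have "cinv (1 - b ^ n) * (\<Sum>i<n. b ^ i)
      = cinv (1 - b ^ n) * ((\<Sum>i<n. b ^ i) * (1 - b)) * cinv (1 - b)"
    by (simp add: mult.assoc cinv_inverse cinvertible)
  also have "\<dots> = cinv (1 - b)"
    by (simp add: one_minus_mult_sum_powers cinv_inverse cinvertible)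
  finally show ?thesis by simp
qed

lemma norm_cinv_one_minus_diff_one_le:
  fixes x :: "'a::cstar_algebra"
  assumes "norm x < 1"
  shows "norm (cinv (1 - x) - 1) \<le> norm x / (1 - norm x)"
proof -
  define h where "h = cinv (1 - x)"
  have h_minus_one: "h - 1 = h * x"
    using cinv_inverse(2)[OF cinvertible_one_minus[OF assms]] by (simp add: h_def algebra_simps)
  have "norm (h - 1) \<le> norm h * norm x" unfolding h_minus_one by (rule norm_mult_ineq)
  also have "\<dots> \<le> (norm (h - 1) + 1) * norm x"
    using norm_triangle_ineq[of "h - 1" 1] by (intro mult_right_mono) auto
  finally have "norm (h - 1) * (1 - norm x) \<le> norm x" by (simp add: algebra_simps)
  then show ?thesis using assms by (simp add: h_def pos_le_divide_eq)
qed

lemma tendsto_cinv_one_minus: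
  fixes f :: "nat \<Rightarrow> 'a::cstar_algebra"
  assumes "f \<longlonglongrightarrow> 0"
  shows "(\<lambda>n. cinv (1 - f n)) \<longlonglongrightarrow> 1"
proof (rule LIM_zero_cancel, rule Lim_null_comparison)
  have "\<forall>\<^sub>F n in sequentially. norm (f n) < 1"
    using tendsto_norm_zero[OF assms] by (rule order_tendstoD) simp
  then show "\<forall>\<^sub>F n in sequentially. norm (cinv (1 - f n) - 1) \<le> norm (f n) / (1 - norm (f n))"
    by (rule eventually_mono) (rule norm_cinv_one_minus_diff_one_le)
  have "(\<lambda>n. norm (f n) / (1 - norm (f n))) \<longlonglongrightarrow> 0 / (1 - 0)"
    by (intro tendsto_intros tendsto_norm_zero assms) simp
  then show "(\<lambda>n. norm (f n) / (1 - norm (f n))) \<longlonglongrightarrow> 0" by simp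
qed

section \<open>Square roots\<close>

text \<open>The iteration \<open>b \<mapsto> (a + b\<^sup>2) / 2\<close> solves \<open>(1 - b)\<^sup>2 = 1 - a\<close>. Its increments are dominated
by those of the scalar iteration with \<open>a = 1\<close>, which makes it converge even when \<open>\<parallel>a\<parallel> = 1\<close>.\<close>

primrec sqrt_iter :: "'a::real_normed_algebra_1 \<Rightarrow> nat \<Rightarrow> 'a" where
  "sqrt_iter a 0 = 0"
| "sqrt_iter a (Suc n) = (1/2) *\<^sub>R (a + sqrt_iter a n * sqrt_iter a n)"

lemma sqrt_iter_one_bounds: "0 \<le> sqrt_iter (1::real) n \<and> sqrt_iter (1::real) n \<le> 1"
  by (induction n) (auto intro: mult_le_one)

lemma norm_sqrt_iter_le:
  assumes "norm a \<le> 1"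
  shows "norm (sqrt_iter a n) \<le> sqrt_iter 1 n"
proof (induction n)
  case (Suc n)
  have "norm (sqrt_iter a n * sqrt_iter a n) \<le> sqrt_iter 1 n * sqrt_iter 1 n"
    by (rule order_trans[OF norm_mult_ineq]) (intro mult_mono Suc; simp add: sqrt_iter_one_bounds)
  with assms have "norm (a + sqrt_iter a n * sqrt_iter a n) \<le> 1 + sqrt_iter 1 n * sqrt_iter 1 n"
    by (intro norm_triangle_mono)
  then show ?case by simp
qed simp

lemma sqrt_iter_commute:
  assumes "z * a = a * z"
  shows "z * sqrt_iter a n = sqrt_iter a n * z"
proof (induction n)
  case (Suc n)
  then have "z * (sqrt_iter a n * sqrt_iter a n) = sqrt_iter a n * sqrt_iter a n * z"
    by (metis mult.assoc)
  with assms show ?case by (simp add: algebra_simps)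
qed simp

lemma sqrt_iter_increment_Suc:
  "sqrt_iter a (Suc (Suc n)) - sqrt_iter a (Suc n)
    = (1/2) *\<^sub>R ((sqrt_iter a (Suc n) - sqrt_iter a n) * (sqrt_iter a (Suc n) + sqrt_iter a n))"
proof -
  define b c where "b = sqrt_iter a n" and "c = sqrt_iter a (Suc n)"
  have "b * c = c * b"
    unfolding b_def c_def by (intro sqrt_iter_commute sqrt_iter_commute[symmetric]) simp
  then have "(c - b) * (c + b) = c * c - b * b" by (simp add: algebra_simps)
  moreover have "sqrt_iter a (Suc (Suc n)) - c = (1/2) *\<^sub>R (c * c - b * b)"
    unfolding sqrt_iter.simps(2)[of a "Suc n"] by (simp add: b_def c_def algebra_simps)
  ultimately show ?thesis by (simp add: b_def c_def del: sqrt_iter.simps)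
qed

lemma norm_sqrt_iter_increment_le:
  assumes "norm a \<le> 1"
  shows "norm (sqrt_iter a (Suc n) - sqrt_iter a n) \<le> sqrt_iter 1 (Suc n) - sqrt_iter 1 n"
proof (induction n)
  case 0
  then show ?case using assms by simp
next
  case (Suc n)
  let ?b = "sqrt_iter a" and ?c = "sqrt_iter (1::real)"
  have "norm (?b (Suc (Suc n)) - ?b (Suc n))
      \<le> 1/2 * (norm (?b (Suc n) - ?b n) * norm (?b (Suc n) + ?b n))"
    unfolding sqrt_iter_increment_Suc
    using norm_mult_ineq[of "?b (Suc n) - ?b n" "?b (Suc n) + ?b n"]
    by (simp del: sqrt_iter.simps)
  also have "\<dots> \<le> 1/2 * ((?c (Suc n) - ?c n) * (?c (Suc n) + ?c n))"
    by (intro mult_left_mono mult_mono Suc norm_triangle_mono norm_sqrt_iter_le assms)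
      (use order_trans[OF norm_ge_zero Suc] in \<open>simp_all del: sqrt_iter.simps\<close>)
  also have "\<dots> = ?c (Suc (Suc n)) - ?c (Suc n)"
    unfolding sqrt_iter_increment_Suc by simp
  finally show ?case .
qed

lemma convergent_sqrt_iter:
  fixes a :: "'a::{real_normed_algebra_1, banach}"
  assumes "norm a \<le> 1"
  shows "convergent (sqrt_iter a)"
proof -
  have "sqrt_iter (1::real) n \<le> sqrt_iter 1 (Suc n)" for n
    using order_trans[OF norm_ge_zero norm_sqrt_iter_increment_le[of "1::real" n]] by simp
  then obtain l where "sqrt_iter (1::real) \<longlonglongrightarrow> l"
    using incseq_convergent[OF incseq_SucI] sqrt_iter_one_bounds by metis
  then have "summable (\<lambda>n. sqrt_iter (1::real) (Suc n) - sqrt_iter 1 n)"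
    by (rule telescope_summable)
  then have "summable (\<lambda>n. sqrt_iter a (Suc n) - sqrt_iter a n)"
    by (rule summable_comparison_test[rotated]) (use norm_sqrt_iter_increment_le[OF assms] in blast)
  then show ?thesis
    using summable_LIMSEQ[of "\<lambda>n. sqrt_iter a (Suc n) - sqrt_iter a n"]
    unfolding sum_lessThan_telescope convergent_def by auto
qed

definition sqrt_one_minus :: "'a::real_normed_algebra_1 \<Rightarrow> 'a" where
  "sqrt_one_minus a = 1 - lim (sqrt_iter a)"

lemma tendsto_sqrt_one_minus:
  fixes a :: "'a::{real_normed_algebra_1, banach}"
  assumes "norm a \<le> 1"
  shows "(\<lambda>n. 1 - sqrt_iter a n) \<longlonglongrightarrow> sqrt_one_minus a"
  unfolding sqrt_one_minus_def
  by (intro tendsto_intros convergent_LIMSEQ_iff[THEN iffD1] convergent_sqrt_iter assms)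

lemma sqrt_one_minus_square:
  fixes a :: "'a::{real_normed_algebra_1, banach}"
  assumes "norm a \<le> 1"
  shows "sqrt_one_minus a * sqrt_one_minus a = 1 - a"
proof -
  define b where "b = lim (sqrt_iter a)"
  have b: "sqrt_iter a \<longlonglongrightarrow> b"
    unfolding b_def using convergent_sqrt_iter[OF assms] by (simp add: convergent_LIMSEQ_iff)
  have "(\<lambda>n. 2 *\<^sub>R sqrt_iter a (Suc n)) \<longlonglongrightarrow> 2 *\<^sub>R b"
    by (intro tendsto_intros LIMSEQ_Suc b)
  moreover have "(\<lambda>n. a + sqrt_iter a n * sqrt_iter a n) \<longlonglongrightarrow> a + b * b"
    by (intro tendsto_intros b)
  then have "(\<lambda>n. 2 *\<^sub>R sqrt_iter a (Suc n)) \<longlonglongrightarrow> a + b * b" by simp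
  ultimately have "2 *\<^sub>R b = a + b * b" by (rule LIMSEQ_unique)
  then show ?thesis by (simp add: sqrt_one_minus_def scaleR_2 algebra_simps flip: b_def)
qed

lemma norm_one_minus_sqrt_one_minus_le:
  fixes a :: "'a::{real_normed_algebra_1, banach}"
  assumes "norm a \<le> 1"
  shows "norm (1 - sqrt_one_minus a) \<le> 1"
proof (rule LIMSEQ_le_const2)
  show "(\<lambda>n. norm (1 - (1 - sqrt_iter a n))) \<longlonglongrightarrow> norm (1 - sqrt_one_minus a)"
    by (intro tendsto_intros tendsto_sqrt_one_minus assms)
  show "\<exists>N. \<forall>n\<ge>N. norm (1 - (1 - sqrt_iter a n)) \<le> 1"
    using norm_sqrt_iter_le[OF assms] sqrt_iter_one_bounds by (auto intro: order_trans)
qed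

lemma sqrt_one_minus_commute:
  fixes a :: "'a::{real_normed_algebra_1, banach}"
  assumes "norm a \<le> 1" "z * a = a * z"
  shows "z * sqrt_one_minus a = sqrt_one_minus a * z"
proof (rule LIMSEQ_unique)
  show "(\<lambda>n. z * (1 - sqrt_iter a n)) \<longlonglongrightarrow> z * sqrt_one_minus a"
    by (intro tendsto_intros tendsto_sqrt_one_minus assms)
  have "(\<lambda>n. (1 - sqrt_iter a n) * z) \<longlonglongrightarrow> sqrt_one_minus a * z"
    by (intro tendsto_intros tendsto_sqrt_one_minus assms)
  then show "(\<lambda>n. z * (1 - sqrt_iter a n)) \<longlonglongrightarrow> sqrt_one_minus a * z"
    by (simp add: left_diff_distrib right_diff_distrib sqrt_iter_commute[OF assms(2)])
qed

lemma self_adj_sqrt_one_minus: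
  fixes a :: "'a::cstar_algebra"
  assumes "norm a \<le> 1" "self_adj a"
  shows "self_adj (sqrt_one_minus a)"
proof (rule LIMSEQ_unique)
  have "self_adj (sqrt_iter a n)" for n
    by (induction n) (simp_all add: adj_simps assms(2))
  then show "(\<lambda>n. 1 - sqrt_iter a n) \<longlonglongrightarrow> cstar_adj (sqrt_one_minus a)"
    using tendsto_adj[OF tendsto_sqrt_one_minus[OF assms(1)]] by (simp add: adj_simps)
qed (rule tendsto_sqrt_one_minus[OF assms(1)])

section \<open>Positivity\<close>

text \<open>For self-adjoint \<open>a\<close> with spectrum in \<open>[0, \<infinity>)\<close> this is the bound
\<open>\<parallel>t - a\<parallel> = max |t - \<lambda>| \<le> t\<close> for large \<open>t\<close>.\<close>

definition norm_positive :: "'a::cstar_algebra \<Rightarrow> bool" where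
  "norm_positive a \<longleftrightarrow> self_adj a \<and> (\<exists>t. norm (t *\<^sub>R 1 - a) \<le> t)"

lemma norm_positive_self_adj: "norm_positive a \<Longrightarrow> self_adj a"
  by (simp add: norm_positive_def)

lemma norm_positive_sqrt:
  fixes a :: "'a::cstar_algebra"
  assumes "norm_positive a"
  shows "\<exists>h. norm_positive h \<and> h * h = a \<and> (\<forall>z. z * a = a * z \<longrightarrow> z * h = h * z)"
proof -
  obtain u where self_adj: "self_adj a" and u: "norm (u *\<^sub>R 1 - a) \<le> u"
    using assms by (auto simp: norm_positive_def)
  define t where "t = u + 1"
  have t: "t > 0" using u norm_ge_zero[of "u *\<^sub>R 1 - a"] unfolding t_def by linarith
  have norm_le: "norm (t *\<^sub>R 1 - a) \<le> t"
    using norm_triangle_ineq[of "u *\<^sub>R 1 - a" 1] u by (simp add: t_def algebra_simps)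
  define b where "b = (1/t) *\<^sub>R (t *\<^sub>R 1 - a)"
  have b: "self_adj b" "norm b \<le> 1"
    using t norm_le self_adj by (auto simp: b_def adj_simps)
  let ?h = "sqrt t *\<^sub>R sqrt_one_minus b"
  show ?thesis
  proof (intro exI[of _ ?h] conjI allI impI)
    have "norm (sqrt t *\<^sub>R 1 - ?h) \<le> sqrt t"
      using norm_one_minus_sqrt_one_minus_le[OF b(2)] t by (simp flip: scaleR_diff_right)
    then show "norm_positive ?h"
      using self_adj_sqrt_one_minus[OF b(2,1)] by (auto simp: norm_positive_def adj_scaleR)
    show "?h * ?h = a"
      using t by (simp add: sqrt_one_minus_square[OF b(2)]) (simp add: b_def scaleR_diff_right)
    show "z * ?h = ?h * z" if "z * a = a * z" for z
    proof -
      have "z * b = b * z" using that by (simp add: b_def algebra_simps)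
      then show ?thesis by (simp add: sqrt_one_minus_commute[OF b(2)])
    qed
  qed
qed

lemma norm_diff_square_le:
  fixes h :: "'a::cstar_algebra"
  assumes h: "self_adj h" and t: "(norm h)\<^sup>2 \<le> t"
  shows "norm (t *\<^sub>R 1 - h * h) \<le> t"
proof (cases "t = 0")
  case False
  then have t_pos: "t > 0" using t zero_le_power2[of "norm h"] by linarith
  define a where "a = (1/t) *\<^sub>R (h * h)"
  have a: "norm a \<le> 1" "self_adj a"
    using h t t_pos by (auto simp: a_def adj_simps norm_self_adj_square)
  define k where "k = sqrt t *\<^sub>R sqrt_one_minus a"
  have square: "k * k = t *\<^sub>R 1 - h * h"
    using t_pos
    by (simp add: k_def sqrt_one_minus_square[OF a(1)]) (simp add: a_def scaleR_diff_right)
  have "h * k = k * h"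
    using sqrt_one_minus_commute[OF a(1), of h] by (simp add: k_def a_def mult.assoc)
  moreover have "self_adj k" by (simp add: k_def adj_scaleR self_adj_sqrt_one_minus[OF a])
  ultimately have "norm k \<le> sqrt t"
    using t_pos by (intro norm_le_of_sum_squares(2)[of h]) (simp_all add: h square)
  then have "norm (k * k) \<le> sqrt t * sqrt t"
    using t_pos by (intro order_trans[OF norm_mult_ineq] mult_mono) auto
  then show ?thesis unfolding square using t_pos by simp
qed (use t in auto)

lemma norm_positive_square: "self_adj h \<Longrightarrow> norm_positive (h * h)"
  using norm_diff_square_le[of h] by (auto simp: norm_positive_def adj_mult)

lemma norm_positive_iff_norm:
  "norm_positive a \<longleftrightarrow> self_adj a \<and> norm (norm a *\<^sub>R 1 - a) \<le> norm (a::'a::cstar_algebra)"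
proof
  assume "norm_positive a"
  then obtain h where h: "norm_positive h" "h * h = a" using norm_positive_sqrt by blast
  then show "self_adj a \<and> norm (norm a *\<^sub>R 1 - a) \<le> norm a"
    using norm_diff_square_le[of h "norm a"] norm_self_adj_square[of h]
    by (auto simp: norm_positive_self_adj adj_mult)
qed (auto simp: norm_positive_def)

lemma norm_positive_limit:
  fixes f :: "nat \<Rightarrow> 'a::cstar_algebra"
  assumes "\<And>n. norm_positive (f n)" and "f \<longlonglongrightarrow> a"
  shows "norm_positive a"
proof -
  have "self_adj a"
    using tendsto_adj[OF assms(2)] assms(2) unfolding norm_positive_self_adj[OF assms(1)]
    by (rule LIMSEQ_unique)
  moreover have "norm (norm a *\<^sub>R 1 - a) \<le> norm a"
    by (rule LIMSEQ_le[of "\<lambda>n. norm (norm (f n) *\<^sub>R 1 - f n)" _ "\<lambda>n. norm (f n)"])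
      (use assms in \<open>auto intro!: tendsto_intros simp: norm_positive_iff_norm\<close>)
  ultimately show ?thesis by (simp add: norm_positive_iff_norm)
qed

lemma cinvertible_norm_positive_add:
  fixes p :: "'a::cstar_algebra"
  assumes "norm_positive p" "e > 0"
  shows "cinvertible (p + e *\<^sub>R 1)"
proof -
  obtain t where "norm (t *\<^sub>R 1 - p) \<le> t" using assms(1) by (auto simp: norm_positive_def)
  then have "norm ((t + e) *\<^sub>R 1 - (p + e *\<^sub>R 1)) < t + e"
    using assms(2) by (simp add: algebra_simps)
  then show ?thesis by (rule cinvertible_near_scalar)
qed

text \<open>\<open>a - d = a (1 - d a\<^sup>-\<^sup>1)\<close> is the square of the product of the commuting roots of both
factors.\<close>

lemma norm_positive_diff_scaleR_one:
  fixes a :: "'a::cstar_algebra"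
  assumes a: "norm_positive a" "cinvertible a" and d: "0 \<le> d" "d * norm (cinv a) \<le> 1"
  shows "norm_positive (a - d *\<^sub>R 1)"
proof -
  obtain h where h: "norm_positive h" "h * h = a" "\<And>z. z * a = a * z \<Longrightarrow> z * h = h * z"
    using norm_positive_sqrt[OF a(1)] by blast
  define q where "q = d *\<^sub>R cinv a"
  have q: "norm q \<le> 1" "self_adj q"
    using d self_adj_cinv[OF a(2)] norm_positive_self_adj[OF a(1)]
    by (simp_all add: q_def adj_scaleR)
  have "cinv a * h = h * cinv a" by (rule h(3)) (simp add: cinv_inverse[OF a(2)])
  then have comm: "h * sqrt_one_minus q = sqrt_one_minus q * h"
    by (intro sqrt_one_minus_commute q(1)) (simp add: q_def)
  define k where "k = h * sqrt_one_minus q"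
  have "self_adj k"
    by (simp add: k_def adj_mult self_adj_sqrt_one_minus[OF q] norm_positive_self_adj[OF h(1)] comm)
  moreover have "k * k = a * (1 - q)"
    unfolding k_def by (metis h(2) comm sqrt_one_minus_square[OF q(1)] mult.assoc)
  ultimately show ?thesis
    using norm_positive_square[of k] by (simp add: q_def right_diff_distrib cinv_inverse[OF a(2)])
qed

lemma real_descent:
  fixes s :: real
  assumes start: "s \<le> b" "P b"
    and step: "\<And>r. s < r \<Longrightarrow> P r \<Longrightarrow> \<exists>r'. s \<le> r' \<and> r' < r \<and> P r'"
    and limit: "\<And>r f. s \<le> r \<Longrightarrow> (\<And>n. r \<le> f n \<and> P (f n)) \<Longrightarrow> f \<longlonglongrightarrow> r \<Longrightarrow> P r"
  shows "P s"
proof -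
  define E where "E = {r. s \<le> r \<and> P r}"
  have E: "E \<noteq> {}" "bdd_below E" using start by (auto simp: E_def bdd_below_def)
  have Inf_ge: "s \<le> Inf E" using E(1) by (rule cInf_greatest) (simp add: E_def)
  obtain f where f: "\<And>n. f n \<in> E" "f \<longlonglongrightarrow> Inf E"
    using closure_contains_Inf[OF E] unfolding closure_sequential by blast
  have "P (Inf E)"
    by (rule limit[OF Inf_ge _ f(2)]) (use f(1) cInf_lower[OF f(1) E(2)] in \<open>simp add: E_def\<close>)
  moreover have "Inf E = s"
  proof (rule ccontr)
    assume "Inf E \<noteq> s"
    then obtain r where "r \<in> E" "r < Inf E"
      using step[OF _ \<open>P (Inf E)\<close>] Inf_ge by (auto simp: E_def)
    then show False using cInf_lower[OF _ E(2)] by fastforce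
  qed
  ultimately show ?thesis by simp
qed

lemma norm_positive_of_cinvertible_shifts:
  fixes x :: "'a::cstar_algebra"
  assumes self_adj: "self_adj x" and inv: "\<And>e. e > 0 \<Longrightarrow> cinvertible (x + e *\<^sub>R 1)"
  shows "norm_positive x"
proof -
  have "norm_positive (x + 0 *\<^sub>R 1)"
  proof (rule real_descent[where P = "\<lambda>e. norm_positive (x + e *\<^sub>R 1)"])
    show "norm_positive (x + norm x *\<^sub>R 1)"
      using self_adj by (auto simp: norm_positive_def adj_simps intro!: exI[of _ "norm x"])
  next
    fix r :: real assume r: "0 < r" and positive: "norm_positive (x + r *\<^sub>R 1)"
    define q where "q = cinv (x + r *\<^sub>R 1)"
    have "q \<noteq> 0" using cinv_inverse[OF inv[OF r]] by (auto simp: q_def)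
    define d where "d = min r (1 / norm q)"
    have "0 < d" "d \<le> r" "d * norm q \<le> 1"
      using r \<open>q \<noteq> 0\<close> by (auto simp: d_def min_def field_simps)
    then have "norm_positive (x + r *\<^sub>R 1 - d *\<^sub>R 1)"
      by (intro norm_positive_diff_scaleR_one positive inv[OF r]) (simp_all add: q_def)
    then show "\<exists>r'. 0 \<le> r' \<and> r' < r \<and> norm_positive (x + r' *\<^sub>R 1)"
      using \<open>0 < d\<close> \<open>d \<le> r\<close> by (intro exI[of _ "r - d"]) (simp add: algebra_simps)
  next
    fix r :: real and f assume "\<And>n. r \<le> f n \<and> norm_positive (x + f n *\<^sub>R 1)" "f \<longlonglongrightarrow> r"
    then show "norm_positive (x + r *\<^sub>R 1)"
      by (intro norm_positive_limit[of "\<lambda>n. x + f n *\<^sub>R 1" "x + r *\<^sub>R 1"] tendsto_intros) simp_all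
  qed simp
  then show ?thesis by simp
qed

lemma cinvertible_self_adj_diff_scal:
  fixes x :: "'a::cstar_algebra"
  assumes self_adj: "self_adj x" and c: "Im c \<noteq> 0"
  shows "cinvertible (x - scal c)"
proof -
  define y where "y = x - Re c *\<^sub>R 1"
  have diff: "x - scal c = y - Im c *\<^sub>R ci" "x - scal (cnj c) = y + Im c *\<^sub>R ci"
    by (simp_all add: y_def cscale_def)
  have product: "(x - scal c) * (x - scal (cnj c)) = y * y + (Im c)\<^sup>2 *\<^sub>R 1"
    "(x - scal (cnj c)) * (x - scal c) = y * y + (Im c)\<^sup>2 *\<^sub>R 1"
    unfolding diff by (simp_all add: algebra_simps ci_central[of y] ci_sq power2_eq_square)
  have "self_adj y" using self_adj by (simp add: y_def adj_simps)
  then have "cinvertible (y * y + (Im c)\<^sup>2 *\<^sub>R 1)"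
    using c by (intro cinvertible_norm_positive_add norm_positive_square) auto
  then show ?thesis
    using cinvertible_of_commuting_mult[of "x - scal c" "x - scal (cnj c)"] by (simp add: product)
qed

lemma positive_iff_norm_positive: "positive x \<longleftrightarrow> norm_positive (x::'a::cstar_algebra)"
proof
  assume x: "positive x"
  show "norm_positive x"
  proof (rule norm_positive_of_cinvertible_shifts)
    show "self_adj x" using x by (simp add: positive_def)
    fix e :: real assume "e > 0"
    then have "complex_of_real (- e) \<notin> elem_spectrum x" using x by (auto simp: positive_def)
    then show "cinvertible (x + e *\<^sub>R 1)"
      by (simp add: elem_spectrum_def scal_minus cscale_of_real)
  qed
next
  assume x: "norm_positive x"
  have "Im c = 0" "0 \<le> Re c" if c: "c \<in> elem_spectrum x" for c
  proof -
    show real: "Im c = 0"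
      using cinvertible_self_adj_diff_scal[OF norm_positive_self_adj[OF x]] c
      by (auto simp: elem_spectrum_def)
    show "0 \<le> Re c"
    proof (rule ccontr)
      assume "\<not> 0 \<le> Re c"
      then have "cinvertible (x + (- Re c) *\<^sub>R 1)" by (intro cinvertible_norm_positive_add x) simp
      then show False using c real by (simp add: elem_spectrum_def cscale_def)
    qed
  qed
  then show "positive x" using norm_positive_self_adj[OF x] by (auto simp: positive_def)
qed

lemmas positive_sqrt = norm_positive_sqrt[folded positive_iff_norm_positive]
  and positive_square = norm_positive_square[folded positive_iff_norm_positive]
  and positive_limit = norm_positive_limit[folded positive_iff_norm_positive]
  and cinvertible_positive_add = cinvertible_norm_positive_add[folded positive_iff_norm_positive]
  and positive_of_cinvertible_shifts =
    norm_positive_of_cinvertible_shifts[folded positive_iff_norm_positive]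

lemma positive_self_adj: "positive a \<Longrightarrow> self_adj a"
  by (simp add: positive_def)

lemma positive_diff_of_norm_le:
  "self_adj x \<Longrightarrow> norm x \<le> t \<Longrightarrow> positive (t *\<^sub>R 1 - (x::'a::cstar_algebra))"
  by (auto simp: positive_iff_norm_positive norm_positive_def adj_simps intro!: exI[of _ t])

lemma positive_add_of_norm_le:
  "self_adj x \<Longrightarrow> norm x \<le> t \<Longrightarrow> positive (t *\<^sub>R 1 + (x::'a::cstar_algebra))"
  using positive_diff_of_norm_le[of "- x" t] by (simp add: adj_minus)

lemma positive_scaleR_one: "r \<ge> 0 \<Longrightarrow> positive (r *\<^sub>R (1::'a::cstar_algebra))"
  using positive_diff_of_norm_le[of "0::'a" r] by simp

lemma positive_zero: "positive (0::'a::cstar_algebra)"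
  using positive_scaleR_one[of 0] by simp

lemma positive_one: "positive (1::'a::cstar_algebra)"
  using positive_scaleR_one[of 1] by simp

lemma positive_add:
  assumes "positive a" "positive (b::'a::cstar_algebra)"
  shows "positive (a + b)"
proof -
  obtain t u where "norm (t *\<^sub>R 1 - a) \<le> t" "norm (u *\<^sub>R 1 - b) \<le> u"
    using assms by (auto simp: positive_iff_norm_positive norm_positive_def)
  then have "norm ((t + u) *\<^sub>R 1 - (a + b)) \<le> t + u"
    using norm_triangle_ineq[of "t *\<^sub>R 1 - a" "u *\<^sub>R 1 - b"] by (simp add: algebra_simps)
  with assms show ?thesis
    by (auto simp: positive_iff_norm_positive norm_positive_def adj_add)
qed

lemma positive_sum: "(\<And>i. i \<in> A \<Longrightarrow> positive (f i)) \<Longrightarrow> positive (\<Sum>i\<in>A. f i :: 'a::cstar_algebra)"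
  by (induction A rule: infinite_finite_induct) (auto intro: positive_zero positive_add)

lemma positive_scaleR:
  assumes "positive (a::'a::cstar_algebra)" "r \<ge> 0"
  shows "positive (r *\<^sub>R a)"
proof -
  obtain h where "positive h" "h * h = a" using positive_sqrt[OF assms(1)] by blast
  then have "positive ((sqrt r *\<^sub>R h) * (sqrt r *\<^sub>R h))"
    by (intro positive_square) (simp add: adj_scaleR positive_self_adj)
  then show ?thesis using assms(2) \<open>h * h = a\<close> by simp
qed

lemma positive_mult:
  assumes "positive (a::'a::cstar_algebra)" "positive b" "a * b = b * a"
  shows "positive (a * b)"
proof -
  obtain h where h: "positive h" "h * h = a" "\<And>z. z * a = a * z \<Longrightarrow> z * h = h * z"
    using positive_sqrt[OF assms(1)] by blast
  obtain k where k: "positive k" "k * k = b" "\<And>z. z * b = b * z \<Longrightarrow> z * k = k * z"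
    using positive_sqrt[OF assms(2)] by blast
  have "b * h = h * b" using h(3) assms(3) by simp
  then have comm: "h * k = k * h" using k(3) by simp
  have "a * b = (h * k) * (h * k)" by (metis h(2) comm k(2) mult.assoc)
  moreover have "self_adj (h * k)"
    using h(1) k(1) comm by (simp add: adj_mult positive_self_adj)
  ultimately show ?thesis by (simp add: positive_square)
qed

lemma norm_le_of_positive:
  fixes z :: "'a::cstar_algebra"
  assumes "positive (T *\<^sub>R 1 - z)" "positive (T *\<^sub>R 1 + z)"
  shows "norm z \<le> T"
proof -
  have z: "self_adj z" using positive_self_adj[OF assms(1)] by (simp add: adj_simps)
  have "positive ((2 * T) *\<^sub>R (1::'a))"
    using positive_add[OF assms] by (simp flip: scaleR_add_left)
  then have T: "T \<ge> 0"
    by (auto simp: positive_iff_norm_positive norm_positive_iff_norm simp flip: scaleR_diff_left)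
  have "positive ((T *\<^sub>R 1 - z) * (T *\<^sub>R 1 + z))"
    by (rule positive_mult[OF assms]) (simp add: algebra_simps)
  also have "(T *\<^sub>R 1 - z) * (T *\<^sub>R 1 + z) = T\<^sup>2 *\<^sub>R 1 - z * z"
    by (simp add: algebra_simps power2_eq_square)
  finally obtain q where q: "positive q" "q * q = T\<^sup>2 *\<^sub>R 1 - z * z"
    "\<And>x. x * (T\<^sup>2 *\<^sub>R 1 - z * z) = (T\<^sup>2 *\<^sub>R 1 - z * z) * x \<Longrightarrow> x * q = q * x"
    using positive_sqrt by blast
  have "z * q = q * z" by (rule q(3)) (simp add: algebra_simps)
  then show ?thesis
    by (rule norm_le_of_sum_squares(1)[OF z positive_self_adj[OF q(1)] _ _ T]) (simp add: q(2))
qed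

lemma norm_le_of_positive_diff:
  fixes z :: "'a::cstar_algebra"
  assumes "positive z" "positive (T *\<^sub>R 1 - z)"
  shows "norm z \<le> T"
  by (rule norm_le_of_positive[OF assms(2)])
    (use positive_add[OF assms(2) positive_add[OF assms(1) assms(1)]] in simp)

lemma not_positive_minus_one: "\<not> positive (- 1 :: 'a::cstar_algebra)"
proof
  assume "positive (- 1 :: 'a)"
  then have "norm (1::'a) \<le> 0"
    using positive_one by (intro norm_le_of_positive) auto
  then show False by simp
qed

section \<open>Positivity of conjugates\<close>

lemma positive_minus_adj_swap:
  fixes c :: "'a::cstar_algebra"
  assumes "positive (- (cstar_adj c * c))"
  shows "positive (- (c * cstar_adj c))"
proof (rule positive_of_cinvertible_shifts)
  fix e :: real assume e: "e > 0"
  have factor: "- (a * b) + e *\<^sub>R 1 = e *\<^sub>R (1 - ((1/e) *\<^sub>R a) * b)" for a b :: 'a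
    using e by (simp add: scaleR_diff_right)
  have "cinvertible (- (cstar_adj c * c) + e *\<^sub>R 1)"
    using assms e by (rule cinvertible_positive_add)
  then have "cinvertible (1 - ((1/e) *\<^sub>R cstar_adj c) * c)"
    using e unfolding factor by (simp add: cinvertible_scaleR_iff)
  then have "cinvertible (1 - c * ((1/e) *\<^sub>R cstar_adj c))"
    by (rule cinvertible_one_minus_mult_swap)
  then show "cinvertible (- (c * cstar_adj c) + e *\<^sub>R 1)"
    using e unfolding factor by (simp add: cinvertible_scaleR_iff)
qed (simp add: adj_simps)

lemma positive_adj_mult_add_mult_adj:
  "positive (cstar_adj c * c + c * cstar_adj (c::'a::cstar_algebra))"
  unfolding adj_mult_add_mult_adj by (intro positive_scaleR positive_add positive_square) auto

lemma adj_mult_eq_0_of_positive_minus: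
  fixes c :: "'a::cstar_algebra"
  assumes "positive (- (cstar_adj c * c))"
  shows "cstar_adj c * c = 0"
proof -
  have "positive ((cstar_adj c * c + c * cstar_adj c) + (- (c * cstar_adj c)))"
    by (intro positive_add positive_adj_mult_add_mult_adj positive_minus_adj_swap assms)
  then have "norm (cstar_adj c * c) \<le> 0"
    using assms by (intro norm_le_of_positive) auto
  then show ?thesis by simp
qed

text \<open>With \<open>b = a\<^sup>* a\<close> and \<open>m = |b|\<close>, the element \<open>d = m - b\<close> is twice the negative part of \<open>b\<close>,
and \<open>c = a d\<close> satisfies \<open>c\<^sup>* c = d b d = - m d\<^sup>2 \<le> 0\<close>. This forces \<open>c\<^sup>* c = 0\<close> and then
\<open>d = 0\<close>.\<close>

theorem positive_adj_mult: "positive (cstar_adj a * (a::'a::cstar_algebra))"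
proof -
  define b where "b = cstar_adj a * a"
  have b: "self_adj b" by (simp add: b_def adj_simps)
  obtain m where m: "positive m" "m * m = b * b"
    "\<And>z. z * (b * b) = b * b * z \<Longrightarrow> z * m = m * z"
    using positive_sqrt[OF positive_square[OF b]] by blast
  have b_commute: "b * m = m * b" by (rule m(3)) (simp add: mult.assoc)
  define d where "d = m - b"
  have d: "self_adj d" using b positive_self_adj[OF m(1)] by (simp add: d_def adj_diff)
  have d_commute: "d * m = m * d" using b_commute by (simp add: d_def algebra_simps)
  have d_square: "d * d = 2 *\<^sub>R (m * d)"
    using b_commute m(2) by (simp add: d_def algebra_simps scaleR_2)
  have d_cube: "d * (d * d) = 2 *\<^sub>R (m * (d * d))"
    by (metis d_square mult.assoc mult_scaleR_left)
  define c where "c = a * d"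
  have "cstar_adj c * c = d * (b * d)"
    by (simp add: c_def adj_mult d b_def mult.assoc)
  also have "\<dots> = d * (m * d) - d * (d * d)"
    by (simp add: d_def algebra_simps)
  also have "\<dots> = - (m * (d * d))"
    unfolding d_cube using d_commute by (simp add: scaleR_2 flip: mult.assoc)
  finally have c_square: "cstar_adj c * c = - (m * (d * d))" .
  have "m * (d * d) = d * d * m" using d_commute by (metis mult.assoc)
  then have "positive (- (cstar_adj c * c))"
    unfolding c_square by (simp add: positive_mult m(1) positive_square d)
  then have "m * (d * d) = 0" using c_square adj_mult_eq_0_of_positive_minus by fastforce
  then have "d = 0" using self_adj_cube_eq_0[OF d] by (simp add: d_cube)
  then show ?thesis using m(1) by (simp add: d_def b_def)
qed

lemma positive_alpha:
  assumes "positive p"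
  shows "positive (alpha a p)"
proof -
  obtain h where h: "positive h" "h * h = p" using positive_sqrt[OF assms] by blast
  have "alpha a p = cstar_adj (h * a) * (h * a)"
    by (simp add: alpha_def adj_mult positive_self_adj[OF h(1)] mult.assoc flip: h(2))
  then show ?thesis by (simp only: positive_adj_mult)
qed

lemma sum_alpha_diff_unimodular:
  fixes p :: "'i \<Rightarrow> 'a::cstar_algebra" and T :: real
  assumes p: "\<And>k. k \<in> A \<Longrightarrow> self_adj (p k)" and w: "\<And>k. k \<in> A \<Longrightarrow> cmod (w k) = 1"
  defines "z \<equiv> \<Sum>k\<in>A. scal (w k) * p k"
  shows "(\<Sum>k\<in>A. alpha (z - T *\<^sub>R scal (w k)) (p k))
    = alpha z (\<Sum>k\<in>A. p k) - (2 * T) *\<^sub>R (cstar_adj z * z) + T\<^sup>2 *\<^sub>R (\<Sum>k\<in>A. p k)"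
proof -
  have adj_z: "cstar_adj z = (\<Sum>k\<in>A. scal (cnj (w k)) * p k)"
    unfolding z_def adj_sum by (intro sum.cong) (simp_all add: adj_scal_mult p)
  have summand: "alpha (z - T *\<^sub>R scal (w k)) (p k)
     = alpha z (p k) - T *\<^sub>R (cstar_adj z * (scal (w k) * p k))
       - T *\<^sub>R ((scal (cnj (w k)) * p k) * z) + T\<^sup>2 *\<^sub>R p k" if "k \<in> A" for k
  proof -
    have "scal (cnj (w k)) * (scal (w k) * p k) = p k"
      using w[OF that] by (simp add: scal_cnj_mult_scal flip: mult.assoc)
    then show ?thesis
      by (simp add: alpha_def adj_diff adj_scaleR adj_scal left_diff_distrib right_diff_distrib
          mult.assoc scal_central[of "p k"] scaleR_diff_right power2_eq_square)
  qed
  have "(\<Sum>k\<in>A. alpha (z - T *\<^sub>R scal (w k)) (p k))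
    = (\<Sum>k\<in>A. alpha z (p k)) - T *\<^sub>R (cstar_adj z * (\<Sum>k\<in>A. scal (w k) * p k))
      - T *\<^sub>R ((\<Sum>k\<in>A. scal (cnj (w k)) * p k) * z) + T\<^sup>2 *\<^sub>R (\<Sum>k\<in>A. p k)"
    by (simp only: summand sum.distrib sum_subtractf sum_distrib_left sum_distrib_right
        scaleR_sum_right cong: sum.cong)
  also have "(\<Sum>k\<in>A. alpha z (p k)) = alpha z (\<Sum>k\<in>A. p k)"
    by (simp add: alpha_def sum_distrib_left sum_distrib_right)
  finally show ?thesis
    unfolding z_def[symmetric] adj_z[symmetric] by (simp add: scaleR_2 flip: scaleR_scaleR)
qed

text \<open>With \<open>z = \<Sum> w\<^sub>k p\<^sub>k\<close>, summing \<open>(z - T w\<^sub>k)\<^sup>* p\<^sub>k (z - T w\<^sub>k) \<ge> 0\<close> and bounding \<open>\<Sum> p\<^sub>k\<close> by \<open>T\<close>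
gives \<open>z\<^sup>* z \<le> T\<^sup>2\<close>.\<close>

lemma norm_unimodular_combination_le:
  fixes p :: "'i \<Rightarrow> 'a::cstar_algebra"
  assumes p: "\<And>k. k \<in> A \<Longrightarrow> positive (p k)" and w: "\<And>k. k \<in> A \<Longrightarrow> cmod (w k) = 1"
  shows "norm (\<Sum>k\<in>A. scal (w k) * p k) \<le> norm (\<Sum>k\<in>A. p k)"
proof (rule dense_ge)
  define z P where "z = (\<Sum>k\<in>A. scal (w k) * p k)" and "P = (\<Sum>k\<in>A. p k)"
  fix T assume "norm (\<Sum>k\<in>A. p k) < T"
  then have T: "norm P < T" by (simp add: P_def)
  then have T_pos: "T > 0" using norm_ge_zero[of P] by linarith
  have "positive P" unfolding P_def by (intro positive_sum p)
  then have P_le: "positive (T *\<^sub>R 1 - P)"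
    using T by (intro positive_diff_of_norm_le positive_self_adj) auto
  have "positive (\<Sum>k\<in>A. alpha (z - T *\<^sub>R scal (w k)) (p k))"
    by (intro positive_sum positive_alpha p)
  then have average: "positive (alpha z P - (2 * T) *\<^sub>R (cstar_adj z * z) + T\<^sup>2 *\<^sub>R P)"
    unfolding z_def P_def by (subst (asm) sum_alpha_diff_unimodular)
      (simp_all add: p w positive_self_adj)
  have "positive (alpha z P - (2 * T) *\<^sub>R (cstar_adj z * z) + T\<^sup>2 *\<^sub>R P
      + alpha z (T *\<^sub>R 1 - P) + T\<^sup>2 *\<^sub>R (T *\<^sub>R 1 - P))"
    by (rule positive_add[OF positive_add[OF average positive_alpha[OF P_le]]
          positive_scaleR[OF P_le]]) simp
  also have "alpha z P - (2 * T) *\<^sub>R (cstar_adj z * z) + T\<^sup>2 *\<^sub>R P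
      + alpha z (T *\<^sub>R 1 - P) + T\<^sup>2 *\<^sub>R (T *\<^sub>R 1 - P)
    = T *\<^sub>R (T\<^sup>2 *\<^sub>R 1 - cstar_adj z * z)"
    by (simp add: alpha_def algebra_simps power2_eq_square scaleR_2 flip: scaleR_scaleR)
  finally have "positive ((1/T) *\<^sub>R (T *\<^sub>R (T\<^sup>2 *\<^sub>R 1 - cstar_adj z * z)))"
    by (rule positive_scaleR) (use T_pos in simp)
  then have "positive (T\<^sup>2 *\<^sub>R 1 - cstar_adj z * z)" using T_pos by simp
  then have "norm (cstar_adj z * z) \<le> T\<^sup>2"
    by (intro norm_le_of_positive_diff positive_adj_mult)
  then show "norm (\<Sum>k\<in>A. scal (w k) * p k) \<le> T"
    using T_pos by (simp add: cstar_identity z_def power_mono_iff)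
qed

section \<open>A discrete Poisson formula\<close>

definition poisson_kernel :: "'a::cstar_algebra \<Rightarrow> 'a" where
  "poisson_kernel b = cinv (1 - b) + cstar_adj (cinv (1 - b)) - 1"

lemma poisson_kernel_eq_alpha:
  fixes b :: "'a::cstar_algebra"
  assumes "norm b < 1"
  shows "poisson_kernel b = alpha (cinv (1 - b)) (1 - cstar_adj b * b)"
proof -
  define g where "g = cinv (1 - b)"
  have inverse: "(1 - b) * g = 1"
    unfolding g_def by (intro cinv_inverse cinvertible_one_minus assms)
  then have b_mult_g: "b * g = g - 1" by (simp add: algebra_simps)
  have "cstar_adj ((1 - b) * g) = 1" using inverse by simp
  then have adj_g_mult_adj_b: "cstar_adj g * cstar_adj b = cstar_adj g - 1"
    by (simp add: adj_simps algebra_simps)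
  have "alpha g (1 - cstar_adj b * b) = cstar_adj g * g - (cstar_adj g * cstar_adj b) * (b * g)"
    by (simp add: alpha_def left_diff_distrib right_diff_distrib mult.assoc)
  also have "\<dots> = poisson_kernel b"
    unfolding b_mult_g adj_g_mult_adj_b by (simp add: poisson_kernel_def algebra_simps flip: g_def)
  finally show ?thesis by (simp add: g_def)
qed

lemma positive_poisson_kernel:
  assumes "norm b < 1"
  shows "positive (poisson_kernel b)"
proof -
  have "norm (cstar_adj b * b) \<le> 1" using assms by (simp add: cstar_identity power_le_one)
  then have "positive (1 *\<^sub>R 1 - cstar_adj b * b)"
    by (intro positive_diff_of_norm_le) (simp_all add: adj_simps)
  then show ?thesis unfolding poisson_kernel_eq_alpha[OF assms] by (simp add: positive_alpha)
qed

definition unity_root :: "nat \<Rightarrow> complex" where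
  "unity_root N = exp (2 * of_real pi * \<i> / of_nat N)"

lemma norm_unity_root [simp]: "cmod (unity_root N) = 1"
  by (simp add: unity_root_def)

lemma unity_root_power: "unity_root N ^ j = exp (2 * of_real pi * \<i> * of_nat j / of_nat N)"
  by (simp add: unity_root_def mult_ac flip: exp_of_nat_mult)

lemma unity_root_power_self: "N > 0 \<Longrightarrow> unity_root N ^ N = 1"
  by (simp add: unity_root_power)

lemma unity_root_power_mult_cnj: "unity_root N ^ j * cnj (unity_root N) ^ j = 1"
  by (simp flip: power_mult_distrib complex_norm_square)

lemma unity_root_orthogonality:
  assumes "j < N" "n < N"
  defines "\<omega> \<equiv> unity_root N"
  shows "(\<Sum>k<N. \<omega> ^ (k * j) * cnj \<omega> ^ (k * n)) = (if j = n then of_nat N else 0)"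
proof -
  define z where "z = \<omega> ^ j * cnj \<omega> ^ n"
  have sum_eq: "(\<Sum>k<N. \<omega> ^ (k * j) * cnj \<omega> ^ (k * n)) = (\<Sum>k<N. z ^ k)"
    by (simp add: z_def power_mult_distrib mult.commute flip: power_mult)
  show ?thesis
  proof (cases "j = n")
    case True
    then show ?thesis
      unfolding sum_eq by (simp add: z_def \<omega>_def unity_root_power_mult_cnj)
  next
    case False
    have "\<omega> ^ j \<noteq> \<omega> ^ n"
      using False assms(1,2) by (simp add: \<omega>_def unity_root_power complex_root_unity_eq)
    then have "z \<noteq> 1"
      unfolding z_def using unity_root_power_mult_cnj[of N n, folded \<omega>_def]
      by (metis mult_right_cancel mult_zero_right zero_neq_one)
    moreover have "z ^ N = (\<omega> ^ N) ^ j * cnj (\<omega> ^ N) ^ n"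
      by (simp add: z_def power_mult_distrib mult.commute flip: power_mult)
    ultimately show ?thesis
      unfolding sum_eq using False assms(1) by (simp add: geometric_sum \<omega>_def unity_root_power_self)
  qed
qed

lemma sum_unity_root_resolvents:
  fixes a :: "'a::cstar_algebra"
  assumes a: "norm a < 1" and j: "j < N"
  defines "\<omega> \<equiv> unity_root N"
  shows "(\<Sum>k<N. scal (\<omega> ^ (k * j)) * cinv (1 - scal (cnj \<omega> ^ k) * a))
    = real N *\<^sub>R (cinv (1 - a ^ N) * a ^ j)"
proof -
  define h where "h = cinv (1 - a ^ N)"
  have resolvent: "cinv (1 - scal (cnj \<omega> ^ k) * a)
      = h * (\<Sum>n<N. scal (cnj \<omega> ^ (k * n)) * a ^ n)" for k
  proof -
    define b where "b = scal (cnj \<omega> ^ k) * a"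
    have power: "b ^ n = scal (cnj \<omega> ^ (k * n)) * a ^ n" for n
      by (simp add: b_def scal_mult_power power_mult)
    have "cnj \<omega> ^ (k * N) = cnj (\<omega> ^ N) ^ k" by (simp add: mult.commute flip: power_mult)
    then have "b ^ N = a ^ N" using j by (simp add: power \<omega>_def unity_root_power_self)
    moreover have "norm b < 1" using a by (simp add: b_def norm_power \<omega>_def)
    ultimately show ?thesis
      using cinv_one_minus_eq_sum[of b N] j by (simp add: power h_def flip: b_def)
  qed
  have "(\<Sum>k<N. scal (\<omega> ^ (k * j)) * cinv (1 - scal (cnj \<omega> ^ k) * a))
    = h * (\<Sum>k<N. \<Sum>n<N. scal (\<omega> ^ (k * j) * cnj \<omega> ^ (k * n)) * a ^ n)"
    by (simp add: resolvent scal_left_commute[of h] sum_distrib_left scal_mult mult.assoc)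
  also have "(\<Sum>k<N. \<Sum>n<N. scal (\<omega> ^ (k * j) * cnj \<omega> ^ (k * n)) * a ^ n)
    = (\<Sum>n<N. scal (\<Sum>k<N. \<omega> ^ (k * j) * cnj \<omega> ^ (k * n)) * a ^ n)"
    by (subst sum.swap) (simp add: scal_sum sum_distrib_right)
  also have "\<dots> = (\<Sum>n<N. if n = j then real N *\<^sub>R a ^ n else 0)"
    using unity_root_orthogonality[OF j] by (intro sum.cong) (auto simp: \<omega>_def cscale_def)
  also have "\<dots> = real N *\<^sub>R a ^ j" using j by simp
  finally show ?thesis by (simp add: h_def)
qed

text \<open>As \<open>N\<close> grows, \<open>(1 - a\<^sup>N)\<^sup>-\<^sup>1\<close> tends to \<open>1\<close>. The average of the kernels below therefore
tends to \<open>1\<close>, and their average weighted by the roots of unity tends to \<open>a\<close>.\<close>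

lemma sum_poisson_kernel:
  fixes a :: "'a::cstar_algebra"
  assumes a: "norm a < 1" and N: "N > 0"
  shows "(\<Sum>k<N. poisson_kernel (scal (cnj (unity_root N) ^ k) * a))
    = real N *\<^sub>R poisson_kernel (a ^ N)"
proof -
  have "(\<Sum>k<N. cinv (1 - scal (cnj (unity_root N) ^ k) * a)) = real N *\<^sub>R cinv (1 - a ^ N)"
    using sum_unity_root_resolvents[OF a N] by simp
  then show ?thesis
    by (simp add: poisson_kernel_def sum.distrib sum_subtractf sum_constant_scaleR adj_scaleR
        scaleR_add_right scaleR_diff_right del: sum_constant flip: adj_sum)
qed

lemma sum_unity_root_poisson_kernel:
  fixes a :: "'a::cstar_algebra"
  assumes a: "norm a < 1" and N: "N \<ge> 2"
  defines "\<omega> \<equiv> unity_root N"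
  shows "(\<Sum>k<N. scal (\<omega> ^ k) * poisson_kernel (scal (cnj \<omega> ^ k) * a))
    = real N *\<^sub>R (cinv (1 - a ^ N) * a + cstar_adj (cinv (1 - a ^ N) * a ^ (N - 1)))"
proof -
  define g where "g k = cinv (1 - scal (cnj \<omega> ^ k) * a)" for k
  have resolvents: "(\<Sum>k<N. scal (\<omega> ^ k) * g k) = real N *\<^sub>R (cinv (1 - a ^ N) * a)"
    using sum_unity_root_resolvents[OF a, of 1 N] N by (simp add: g_def \<omega>_def)
  have "cnj \<omega> ^ k = \<omega> ^ (k * (N - 1))" for k
  proof -
    have "\<omega> ^ (k * (N - 1)) * \<omega> ^ k = (\<omega> ^ N) ^ k"
      using N by (cases N) (simp_all add: algebra_simps flip: power_add power_mult)
    then have "\<omega> ^ (k * (N - 1)) * \<omega> ^ k = \<omega> ^ k * cnj \<omega> ^ k"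
      using N by (simp add: \<omega>_def unity_root_power_self unity_root_power_mult_cnj)
    then show ?thesis by (simp add: \<omega>_def unity_root_def)
  qed
  then have "(\<Sum>k<N. scal (cnj \<omega> ^ k) * g k) = real N *\<^sub>R (cinv (1 - a ^ N) * a ^ (N - 1))"
    using sum_unity_root_resolvents[OF a, of "N - 1" N] N by (simp add: g_def \<omega>_def)
  moreover have "(\<Sum>k<N. scal (\<omega> ^ k) * cstar_adj (g k)) = cstar_adj (\<Sum>k<N. scal (cnj \<omega> ^ k) * g k)"
    by (simp add: adj_sum adj_scal_mult)
  ultimately have adjoints: "(\<Sum>k<N. scal (\<omega> ^ k) * cstar_adj (g k))
      = real N *\<^sub>R cstar_adj (cinv (1 - a ^ N) * a ^ (N - 1))"
    by (simp add: adj_scaleR)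
  have "(\<Sum>k<N. \<omega> ^ k) = 0"
    using unity_root_orthogonality[of 1 N 0] N by (simp add: \<omega>_def)
  then have "(\<Sum>k<N. scal (\<omega> ^ k) :: 'a) = 0" by (simp flip: scal_sum)
  then show ?thesis
    using resolvents adjoints
    by (simp add: poisson_kernel_def right_diff_distrib distrib_left sum.distrib sum_subtractf
        scaleR_add_right flip: g_def)
qed

section \<open>Positive maps and the Russo--Dye theorem\<close>

lemma positive_map_linear: "positive_map f \<Longrightarrow> linear f"
  unfolding positive_map_def clinear_map_def by (metis linearI cscale_of_real)

lemma positive_map_scal: "positive_map f \<Longrightarrow> f (scal c * x) = scal c * f x"
  unfolding positive_map_def clinear_map_def by (metis cscale_eq_scal_mult)

lemma positive_mapD: "positive_map f \<Longrightarrow> positive x \<Longrightarrow> positive (f x)"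
  by (simp add: positive_map_def)

lemma positive_map_self_adj:
  assumes \<psi>: "positive_map \<psi>" and h: "self_adj h"
  shows "self_adj (\<psi> h)" "norm (\<psi> h) \<le> norm (\<psi> 1) * norm h"
proof -
  note lin = positive_map_linear[OF \<psi>]
  have image_one: "positive (\<psi> 1)" by (intro positive_mapD[OF \<psi>] positive_one)
  have "positive (norm h *\<^sub>R 1 + h)" using h by (intro positive_add_of_norm_le) auto
  from positive_mapD[OF \<psi> this] have add: "positive (norm h *\<^sub>R \<psi> 1 + \<psi> h)"
    by (simp add: linear_add[OF lin] linear_scale[OF lin])
  then show "self_adj (\<psi> h)"
    using positive_self_adj[OF add] positive_self_adj[OF image_one] by (simp add: adj_simps)
  have "positive (norm h *\<^sub>R 1 - h)" using h by (intro positive_diff_of_norm_le) auto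
  from positive_mapD[OF \<psi> this] have diff: "positive (norm h *\<^sub>R \<psi> 1 - \<psi> h)"
    by (simp add: linear_diff[OF lin] linear_scale[OF lin])
  have "positive (norm (\<psi> 1) *\<^sub>R 1 - \<psi> 1)"
    by (intro positive_diff_of_norm_le positive_self_adj image_one) simp
  then have bound: "positive (norm h *\<^sub>R (norm (\<psi> 1) *\<^sub>R 1 - \<psi> 1))" by (rule positive_scaleR) simp
  show "norm (\<psi> h) \<le> norm (\<psi> 1) * norm h"
    using positive_add[OF bound add] positive_add[OF bound diff]
    by (intro norm_le_of_positive) (simp_all add: scaleR_diff_right mult.commute)
qed

lemma positive_map_eq_cartesian:
  assumes "positive_map \<psi>"
  shows "\<psi> x = \<psi> (re_part x) + ci * \<psi> (im_part x)"
proof -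
  have "\<psi> x = \<psi> (re_part x + scal \<i> * im_part x)" by (simp add: scal_ii re_part_add_im_part)
  then show ?thesis
    by (simp only: linear_add[OF positive_map_linear[OF assms]] positive_map_scal[OF assms])
      (simp add: scal_ii)
qed

lemma positive_map_adj:
  assumes \<psi>: "positive_map \<psi>"
  shows "\<psi> (cstar_adj x) = cstar_adj (\<psi> x)"
proof -
  have "cstar_adj x = re_part x + scal (- \<i>) * im_part x"
    using adj_add_ci_mult[of "re_part x" "im_part x"]
    by (simp add: re_part_add_im_part scal_minus scal_ii)
  then have "\<psi> (cstar_adj x) = \<psi> (re_part x) - ci * \<psi> (im_part x)"
    by (simp only: linear_add[OF positive_map_linear[OF \<psi>]] positive_map_scal[OF \<psi>])
      (simp add: scal_minus scal_ii)
  also have "\<dots> = cstar_adj (\<psi> (re_part x) + ci * \<psi> (im_part x))"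
    by (simp add: adj_add_ci_mult positive_map_self_adj[OF \<psi>])
  finally show ?thesis by (simp flip: positive_map_eq_cartesian[OF \<psi>])
qed

lemma positive_map_bounded_linear:
  fixes \<psi> :: "'a::cstar_algebra \<Rightarrow> 'a"
  assumes \<psi>: "positive_map \<psi>"
  shows "bounded_linear \<psi>"
proof (rule bounded_linear_intro)
  fix x :: 'a
  have bound: "norm (\<psi> h) \<le> norm x * norm (\<psi> 1)" if "self_adj h" "norm h \<le> norm x" for h
    using positive_map_self_adj(2)[OF \<psi> that(1)] mult_left_mono[OF that(2) norm_ge_zero[of "\<psi> 1"]]
    by (simp add: mult.commute)
  have "norm (\<psi> x) \<le> norm (\<psi> (re_part x)) + norm (\<psi> (im_part x))"
    unfolding positive_map_eq_cartesian[OF \<psi>, of x]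
    using norm_triangle_ineq[of "\<psi> (re_part x)" "ci * \<psi> (im_part x)"] by simp
  also have "\<dots> \<le> norm x * norm (\<psi> 1) + norm x * norm (\<psi> 1)"
    by (intro add_mono bound) (simp_all add: norm_re_part_le norm_im_part_le)
  finally show "norm (\<psi> x) \<le> norm x * (2 * norm (\<psi> 1))" by simp
qed (simp_all add: linear_add linear_scale positive_map_linear[OF \<psi>])

lemma positive_map_poisson_norm_le:
  fixes a :: "'a::cstar_algebra"
  assumes \<psi>: "positive_map \<psi>" and a: "norm a < 1" and N: "N \<ge> 2"
  shows "norm (\<psi> (cinv (1 - a ^ N) * a + cstar_adj (cinv (1 - a ^ N) * a ^ (N - 1))))
    \<le> norm (\<psi> (poisson_kernel (a ^ N)))"
proof -
  note lin = positive_map_linear[OF \<psi>]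
  define \<omega> where "\<omega> = unity_root N"
  define p where "p k = poisson_kernel (scal (cnj \<omega> ^ k) * a)" for k
  have "positive (p k)" for k
    unfolding p_def using a by (intro positive_poisson_kernel) (simp add: norm_power \<omega>_def)
  then have "norm (\<Sum>k<N. scal (\<omega> ^ k) * \<psi> (p k)) \<le> norm (\<Sum>k<N. \<psi> (p k))"
    by (intro norm_unimodular_combination_le positive_mapD[OF \<psi>]) (simp_all add: \<omega>_def norm_power)
  then have "norm (\<psi> (\<Sum>k<N. scal (\<omega> ^ k) * p k)) \<le> norm (\<psi> (\<Sum>k<N. p k))"
    by (simp add: linear_sum[OF lin] positive_map_scal[OF \<psi>])
  moreover have "(\<Sum>k<N. p k) = real N *\<^sub>R poisson_kernel (a ^ N)"
    using sum_poisson_kernel[OF a, of N] N by (simp add: p_def \<omega>_def)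
  ultimately show ?thesis
    using N by (simp add: p_def \<omega>_def sum_unity_root_poisson_kernel[OF a N] linear_scale[OF lin])
qed

lemma positive_map_norm_le_of_norm_less_one:
  fixes a :: "'a::cstar_algebra"
  assumes \<psi>: "positive_map \<psi>" and a: "norm a < 1"
  shows "norm (\<psi> a) \<le> norm (\<psi> 1)"
proof -
  have powers: "(\<lambda>N. a ^ N) \<longlonglongrightarrow> 0" by (rule LIMSEQ_power_zero[OF a])
  have shifted: "(\<lambda>N. a ^ (N - 1)) \<longlonglongrightarrow> 0" by (rule LIMSEQ_offset[where k = 1]) (simp add: powers)
  note resolvents = tendsto_cinv_one_minus[OF powers]
  note limits = tendsto_intros tendsto_adj resolvents shifted
    bounded_linear.tendsto[OF positive_map_bounded_linear[OF \<psi>]]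
  have "(\<lambda>N. norm (\<psi> (cinv (1 - a ^ N) * a + cstar_adj (cinv (1 - a ^ N) * a ^ (N - 1)))))
      \<longlonglongrightarrow> norm (\<psi> (1 * a + cstar_adj (1 * 0)))"
    by (intro limits)
  moreover have "(\<lambda>N. norm (\<psi> (poisson_kernel (a ^ N)))) \<longlonglongrightarrow> norm (\<psi> (1 + cstar_adj 1 - 1))"
    unfolding poisson_kernel_def by (intro limits)
  ultimately have "norm (\<psi> (1 * a + cstar_adj (1 * 0))) \<le> norm (\<psi> (1 + cstar_adj 1 - 1))"
    by (rule LIMSEQ_le) (use positive_map_poisson_norm_le[OF \<psi> a] in blast)
  then show ?thesis by simp
qed

theorem onorm_positive_map:
  fixes \<psi> :: "'a::cstar_algebra \<Rightarrow> 'a"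
  assumes \<psi>: "positive_map \<psi>"
  shows "onorm \<psi> = norm (\<psi> 1)"
proof (rule antisym)
  note bounded = positive_map_bounded_linear[OF \<psi>]
  have unit_ball: "norm (\<psi> a) \<le> norm (\<psi> 1)" if "norm a \<le> 1" for a
  proof (rule continuous_le_on_closure[of "ball 0 1" "\<lambda>a. norm (\<psi> a)"])
    show "continuous_on (closure (ball 0 1)) (\<lambda>a. norm (\<psi> a))"
      by (intro continuous_on_norm linear_continuous_on bounded)
  qed (use that positive_map_norm_le_of_norm_less_one[OF \<psi>] in auto)
  show "onorm \<psi> \<le> norm (\<psi> 1)"
  proof (rule onorm_bound)
    fix x
    have "norm (\<psi> ((1 / norm x) *\<^sub>R x)) \<le> norm (\<psi> 1)" if "x \<noteq> 0"
      using that by (intro unit_ball) simp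
    then show "norm (\<psi> x) \<le> norm (\<psi> 1) * norm x"
      by (cases "x = 0")
        (simp_all add: linear_0 linear_scale positive_map_linear[OF \<psi>] divide_le_eq)
  qed simp
  show "norm (\<psi> 1) \<le> onorm \<psi>" using onorm[OF bounded, of 1] by simp
qed

section \<open>Elementary similarity\<close>

lemma alpha_inv_eq_alpha_cinv: "alpha_inv a = alpha (cinv a)"
  by (simp add: fun_eq_iff alpha_def alpha_inv_def)

lemma alpha_alpha: "alpha a (alpha b x) = alpha (b * a) x"
  by (simp add: alpha_def adj_mult mult.assoc)

lemma alpha_alpha_inv:
  assumes "cinvertible a"
  shows "alpha a (alpha_inv a x) = x" "alpha_inv a (alpha a x) = x"
  unfolding alpha_inv_eq_alpha_cinv alpha_alpha by (simp_all add: cinv_inverse[OF assms] alpha_def)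

lemma bij_alpha:
  assumes "cinvertible a"
  shows "bij (alpha a)" "bij (alpha_inv a)"
  using alpha_alpha_inv[OF assms] by (metis bijI')+

lemma clinear_map_alpha: "clinear_map (alpha a)"
  unfolding clinear_map_def
proof (intro conjI allI)
  show "alpha a (cscale c x) = cscale c (alpha a x)" for c x
    unfolding cscale_eq_scal_mult[of c x] cscale_eq_scal_mult[of c "alpha a x"]
    by (simp add: alpha_def scal_left_commute mult.assoc)
qed (simp add: alpha_def algebra_simps)

lemma positive_map_alpha: "positive_map (alpha a)"
  by (simp add: positive_map_def clinear_map_alpha positive_alpha)

lemma positive_map_comp: "positive_map f \<Longrightarrow> positive_map g \<Longrightarrow> positive_map (f \<circ> g)"
  by (simp add: positive_map_def clinear_map_def)

lemma positive_map_similar: "positive_map \<phi> \<Longrightarrow> positive_map (alpha_inv a \<circ> \<phi> \<circ> alpha a)"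
  unfolding alpha_inv_eq_alpha_cinv by (intro positive_map_comp positive_map_alpha)

lemma elem_similar_sym:
  assumes "elem_similar \<phi> \<psi>"
  shows "elem_similar \<psi> \<phi>"
proof -
  obtain a where a: "cinvertible a" "\<phi> = alpha_inv a \<circ> \<psi> \<circ> alpha a"
    using assms by (auto simp: elem_similar_def)
  have "\<psi> = alpha a \<circ> \<phi> \<circ> alpha_inv a"
    by (simp add: fun_eq_iff a(2) alpha_alpha_inv[OF a(1)])
  then have "\<psi> = alpha_inv (cinv a) \<circ> \<phi> \<circ> alpha (cinv a)"
    by (simp add: alpha_inv_eq_alpha_cinv cinvertible_cinv[OF a(1)])
  then show ?thesis using cinvertible_cinv[OF a(1)] by (auto simp: elem_similar_def)
qed

lemma elem_similar_conj: "cinvertible a \<Longrightarrow> elem_similar \<phi> (alpha_inv a \<circ> \<phi> \<circ> alpha a)"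
  by (rule elem_similar_sym) (auto simp: elem_similar_def)

lemma elem_similar_diff_cscale:
  assumes "\<phi> = alpha_inv a \<circ> \<psi> \<circ> alpha a" "cinvertible a"
  shows "\<phi> x - cscale c x = alpha_inv a (\<psi> (alpha a x) - cscale c (alpha a x))"
proof -
  have "clinear_map (alpha_inv a)" unfolding alpha_inv_eq_alpha_cinv by (rule clinear_map_alpha)
  moreover have "alpha_inv a (y - z) = alpha_inv a y - alpha_inv a z" for y z
    by (simp add: alpha_inv_def left_diff_distrib right_diff_distrib)
  ultimately show ?thesis
    by (simp add: assms(1) clinear_map_def alpha_alpha_inv[OF assms(2)])
qed

lemma op_spectrum_elem_similar:
  assumes "elem_similar \<phi> \<psi>"
  shows "op_spectrum \<phi> = op_spectrum \<psi>"
proof -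
  have "op_spectrum \<phi> \<subseteq> op_spectrum \<psi>" if "elem_similar \<phi> \<psi>" for \<phi> \<psi> :: "'a \<Rightarrow> 'a"
  proof -
    obtain a where a: "\<phi> = alpha_inv a \<circ> \<psi> \<circ> alpha a" "cinvertible a"
      using \<open>elem_similar \<phi> \<psi>\<close> by (auto simp: elem_similar_def)
    have "bij (\<lambda>x. \<phi> x - cscale c x)" if "bij (\<lambda>x. \<psi> x - cscale c x)" for c
    proof -
      have "(\<lambda>x. \<phi> x - cscale c x) = alpha_inv a \<circ> (\<lambda>x. \<psi> x - cscale c x) \<circ> alpha a"
        by (simp add: fun_eq_iff elem_similar_diff_cscale[OF a])
      then show ?thesis using that bij_alpha[OF a(2)] by (simp add: bij_comp)
    qed
    then show ?thesis by (auto simp: op_spectrum_def)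
  qed
  then show ?thesis using assms elem_similar_sym by blast
qed

section \<open>Positive resolvents\<close>

lemma bij_id_minus_contraction:
  fixes g :: "'a::banach \<Rightarrow> 'a"
  assumes g: "bounded_linear g" "onorm g < 1"
  shows "bij (\<lambda>x. x - g x)"
proof -
  have "dist (y + g x) (y + g x') \<le> onorm g * dist x x'" for x x' y
    using onorm[OF g(1), of "x - x'"]
    by (simp add: dist_norm linear_diff[OF bounded_linear.linear[OF g(1)]])
  then have "\<exists>!x. y + g x = x" for y
    by (intro banach_fix_type[of "onorm g"] onorm_pos_le g) simp
  moreover have "y + g x = x \<longleftrightarrow> x - g x = y" for x y by (auto simp: algebra_simps)
  ultimately show ?thesis by (simp add: bij_iff)
qed

lemma tendsto_funpow_contraction:
  fixes g :: "'a::real_normed_vector \<Rightarrow> 'a"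
  assumes g: "bounded_linear g" "onorm g < 1"
  shows "(\<lambda>n. (g ^^ n) x) \<longlonglongrightarrow> 0"
proof (rule Lim_null_comparison)
  have "norm ((g ^^ n) x) \<le> onorm g ^ n * norm x" for n
  proof (induction n)
    case (Suc n)
    have "norm ((g ^^ Suc n) x) \<le> onorm g * norm ((g ^^ n) x)" by (simp add: onorm[OF g(1)])
    also have "\<dots> \<le> onorm g * (onorm g ^ n * norm x)"
      by (intro mult_left_mono Suc onorm_pos_le g(1))
    finally show ?case by (simp add: mult.assoc)
  qed simp
  then show "\<forall>\<^sub>F n in sequentially. norm ((g ^^ n) x) \<le> onorm g ^ n * norm x" by simp
  have "(\<lambda>n. onorm g ^ n * norm x) \<longlonglongrightarrow> 0 * norm x"
    using g onorm_pos_le[OF g(1)] by (intro tendsto_intros LIMSEQ_power_zero) auto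
  then show "(\<lambda>n. onorm g ^ n * norm x) \<longlonglongrightarrow> 0" by simp
qed

lemma positive_of_positive_diff_contraction:
  fixes g :: "'a::cstar_algebra \<Rightarrow> 'a"
  assumes g: "bounded_linear g" "onorm g < 1"
    and pos: "\<And>x. positive x \<Longrightarrow> positive (g x)" and diff: "positive (x - g x)"
  shows "positive x"
proof (rule positive_limit)
  show "positive (x - (g ^^ n) x)" for n
  proof (induction n)
    case (Suc n)
    have "positive ((x - g x) + g (x - (g ^^ n) x))" by (intro positive_add pos diff Suc)
    then show ?case by (simp add: linear_diff[OF bounded_linear.linear[OF g(1)]])
  qed (simp add: positive_zero)
  show "(\<lambda>n. x - (g ^^ n) x) \<longlonglongrightarrow> x"
    using tendsto_diff[OF tendsto_const tendsto_funpow_contraction[OF g]] by simp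
qed

lemma cmod_op_spectrum_le_onorm:
  fixes f :: "'a::cstar_algebra \<Rightarrow> 'a"
  assumes f: "bounded_linear f" and c: "c \<in> op_spectrum f"
  shows "cmod c \<le> onorm f"
proof (rule ccontr)
  assume "\<not> cmod c \<le> onorm f"
  then have less: "onorm f < cmod c" by simp
  then have "c \<noteq> 0" using onorm_pos_le[OF f] by auto
  define g where "g x = scal (1 / c) * f x" for x
  have "norm (g x) \<le> (onorm f / cmod c) * norm x" for x
    using onorm[OF f, of x] by (simp add: g_def norm_divide divide_right_mono)
  then have "onorm g \<le> onorm f / cmod c" by (intro onorm_bound) (simp_all add: onorm_pos_le[OF f])
  also have "\<dots> < 1" using less onorm_pos_le[OF f] by (simp add: divide_less_eq)
  finally have "bij (\<lambda>x. x - g x)"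
    unfolding g_def by (intro bij_id_minus_contraction bounded_linear_const_mult f)
  moreover have "bij (\<lambda>x::'a. scal (- c) * x)"
    by (rule bij_betw_byWitness[where f' = "\<lambda>x. scal (1 / - c) * x"])
      (use \<open>c \<noteq> 0\<close> in \<open>auto simp flip: mult.assoc scal_mult\<close>)
  ultimately have "bij ((\<lambda>x. scal (- c) * x) \<circ> (\<lambda>x. x - g x))" by (rule bij_comp)
  moreover have "scal (- c) * (x - g x) = f x - cscale c x" for x
  proof -
    have "scal c * g x = f x" using \<open>c \<noteq> 0\<close> by (simp add: g_def flip: mult.assoc scal_mult)
    then show ?thesis
      by (simp add: scal_minus right_diff_distrib cscale_eq_scal_mult[of c x])
  qed
  ultimately have "bij (\<lambda>x. f x - cscale c x)" by (simp add: comp_def)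
  then show False using c by (simp add: op_spectrum_def)
qed

lemma bij_real_resolvent_iff:
  "bij (\<lambda>x. r *\<^sub>R x - f x) \<longleftrightarrow> complex_of_real r \<notin> op_spectrum (f :: 'a::cstar_algebra \<Rightarrow> 'a)"
proof -
  have swap: "bij (\<lambda>x. h x - g x)" if "bij (\<lambda>x. g x - h x)" for g h :: "'a \<Rightarrow> 'a"
    using bij_comp[OF that bij_uminus] by (simp add: comp_def)
  show ?thesis
    using swap[of "\<lambda>x. r *\<^sub>R x" f] swap[of f "\<lambda>x. r *\<^sub>R x"]
    by (auto simp: op_spectrum_def cscale_of_real)
qed

definition positive_resolvent :: "('a::cstar_algebra \<Rightarrow> 'a) \<Rightarrow> real \<Rightarrow> bool" where
  "positive_resolvent \<phi> r \<longleftrightarrow>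
    bij (\<lambda>x. r *\<^sub>R x - \<phi> x) \<and> (\<forall>x. positive (r *\<^sub>R x - \<phi> x) \<longrightarrow> positive x)"

lemma positive_resolvent_of_onorm_less:
  assumes \<psi>: "positive_map \<psi>" and r: "onorm \<psi> < r"
  shows "positive_resolvent \<psi> r"
  unfolding positive_resolvent_def
proof (intro conjI allI impI)
  note bounded = positive_map_bounded_linear[OF \<psi>]
  have "r > 0" using onorm_pos_le[OF bounded] r by simp
  then show "bij (\<lambda>x. r *\<^sub>R x - \<psi> x)"
    unfolding bij_real_resolvent_iff using cmod_op_spectrum_le_onorm[OF bounded] r by fastforce
  fix x assume "positive (r *\<^sub>R x - \<psi> x)"
  then have "positive ((1/r) *\<^sub>R (r *\<^sub>R x - \<psi> x))"
    using \<open>r > 0\<close> by (intro positive_scaleR) auto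
  then have "positive (x - (1/r) *\<^sub>R \<psi> x)" using \<open>r > 0\<close> by (simp add: scaleR_diff_right)
  moreover have "onorm (\<lambda>x. (1/r) *\<^sub>R \<psi> x) < 1"
    using r \<open>r > 0\<close> by (simp add: onorm_scaleR[OF bounded])
  moreover have "positive ((1/r) *\<^sub>R \<psi> y)" if "positive y" for y
    using \<open>r > 0\<close> by (intro positive_scaleR positive_mapD[OF \<psi> that]) simp
  ultimately show "positive x"
    using positive_of_positive_diff_contraction[OF bounded_linear_const_scaleR[OF bounded]] by blast
qed

lemma positive_resolvent_elem_similar:
  assumes sim: "elem_similar \<phi> \<psi>" and res: "positive_resolvent \<psi> r"
  shows "positive_resolvent \<phi> r"
  unfolding positive_resolvent_def
proof (intro conjI allI impI)
  show "bij (\<lambda>x. r *\<^sub>R x - \<phi> x)"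
    using res op_spectrum_elem_similar[OF sim]
    by (simp add: positive_resolvent_def bij_real_resolvent_iff)
  obtain a where a: "\<phi> = alpha_inv a \<circ> \<psi> \<circ> alpha a" "cinvertible a"
    using sim by (auto simp: elem_similar_def)
  note lin = positive_map_linear[OF positive_map_alpha[of a]]
  fix x assume "positive (r *\<^sub>R x - \<phi> x)"
  then have "positive (alpha a (r *\<^sub>R x - \<phi> x))" by (rule positive_alpha)
  then have "positive (r *\<^sub>R alpha a x - \<psi> (alpha a x))"
    by (simp add: a(1) linear_diff[OF lin] linear_scale[OF lin] alpha_alpha_inv[OF a(2)])
  then have "positive (alpha a x)" using res unfolding positive_resolvent_def by blast
  then have "positive (alpha_inv a (alpha a x))"
    unfolding alpha_inv_eq_alpha_cinv by (rule positive_alpha)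
  then show "positive x" by (simp add: alpha_alpha_inv[OF a(2)])
qed

definition positively_solvable :: "('a::cstar_algebra \<Rightarrow> 'a) \<Rightarrow> real \<Rightarrow> bool" where
  "positively_solvable \<phi> r \<longleftrightarrow> (\<exists>y. positive y \<and> r *\<^sub>R y - \<phi> y = 1)"

lemma positively_solvable_iff:
  fixes \<phi> :: "'a::cstar_algebra \<Rightarrow> 'a"
  assumes lin: "linear \<phi>" and s: "s > 0"
  shows "positively_solvable \<phi> s \<longleftrightarrow> (\<exists>w. positive w \<and> \<phi> w = s *\<^sub>R (w - 1))"
proof
  assume "positively_solvable \<phi> s"
  then obtain y where y: "positive y" "\<phi> y = s *\<^sub>R y - 1"
    by (auto simp: positively_solvable_def algebra_simps)
  have "positive (s *\<^sub>R y) \<and> \<phi> (s *\<^sub>R y) = s *\<^sub>R (s *\<^sub>R y - 1)"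
    using s y by (simp add: positive_scaleR linear_scale[OF lin])
  then show "\<exists>w. positive w \<and> \<phi> w = s *\<^sub>R (w - 1)" ..
next
  assume "\<exists>w. positive w \<and> \<phi> w = s *\<^sub>R (w - 1)"
  then obtain w where "positive w" "\<phi> w = s *\<^sub>R (w - 1)" by blast
  then have "positive ((1/s) *\<^sub>R w) \<and> s *\<^sub>R ((1/s) *\<^sub>R w) - \<phi> ((1/s) *\<^sub>R w) = 1"
    using s by (simp add: positive_scaleR linear_scale[OF lin])
  then show "positively_solvable \<phi> s" unfolding positively_solvable_def ..
qed

lemma positively_solvable_of_positive_resolvent:
  assumes "positive_resolvent \<phi> r"
  shows "positively_solvable \<phi> r"
proof -
  have "bij (\<lambda>x. r *\<^sub>R x - \<phi> x)" using assms unfolding positive_resolvent_def by blast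
  then obtain y where y: "r *\<^sub>R y - \<phi> y = 1"
    using surjD[OF bij_is_surj, of "\<lambda>x. r *\<^sub>R x - \<phi> x" 1] by auto
  then have "positive (r *\<^sub>R y - \<phi> y)" by (simp add: positive_one)
  then have "positive y" using assms unfolding positive_resolvent_def by blast
  with y show ?thesis by (auto simp: positively_solvable_def)
qed

lemma strictly_positive_sqrt:
  assumes "strictly_positive y"
  shows "\<exists>v. strictly_positive v \<and> v * v = y"
proof -
  obtain v where "positive v" "v * v = y"
    using positive_sqrt assms unfolding strictly_positive_def by blast
  moreover have "cinvertible v"
    using cinvertible_of_commuting_mult[of v v] assms \<open>v * v = y\<close>
    by (simp add: strictly_positive_def)
  ultimately show ?thesis by (auto simp: strictly_positive_def)
qed

lemma similar_onorm_less_of_positively_solvable: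
  fixes \<phi> :: "'a::cstar_algebra \<Rightarrow> 'a"
  assumes \<phi>: "positive_map \<phi>" and r: "r > 0" and solvable: "positively_solvable \<phi> r"
  shows "\<exists>v. strictly_positive v \<and> onorm (alpha_inv v \<circ> \<phi> \<circ> alpha v) < r"
proof -
  obtain y where y: "positive y" "\<phi> y = r *\<^sub>R y - 1"
    using solvable by (auto simp: positively_solvable_def algebra_simps)
  have "cinvertible (r *\<^sub>R y)"
    using cinvertible_positive_add[OF positive_mapD[OF \<phi> y(1)], of 1] by (simp add: y(2))
  then have "strictly_positive y"
    using r y(1) by (simp add: strictly_positive_def cinvertible_scaleR_iff)
  then obtain v where v: "strictly_positive v" "v * v = y" using strictly_positive_sqrt by blast
  then have v_inv: "cinvertible v" "alpha v 1 = y"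
    by (simp_all add: strictly_positive_def alpha_def positive_self_adj)
  note lin = positive_map_linear[OF positive_map_alpha[of "cinv v"], folded alpha_inv_eq_alpha_cinv]
  have conj_y: "alpha_inv v y = 1" using alpha_alpha_inv(2)[OF v_inv(1), of 1] v_inv(2) by simp
  define \<psi> where "\<psi> = alpha_inv v \<circ> \<phi> \<circ> alpha v"
  have \<psi>: "positive_map \<psi>" unfolding \<psi>_def by (rule positive_map_similar[OF \<phi>])
  have \<psi>_one: "\<psi> 1 = r *\<^sub>R 1 - alpha_inv v 1"
    by (simp add: \<psi>_def v_inv(2) y(2) linear_diff[OF lin] linear_scale[OF lin] conj_y)
  have "y \<noteq> 0" using conj_y linear_0[OF lin] by auto
  have "positive (alpha_inv v (norm y *\<^sub>R 1 - y))"
    unfolding alpha_inv_eq_alpha_cinv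
    by (intro positive_alpha positive_diff_of_norm_le positive_self_adj y(1)) simp
  then have "positive ((1 / norm y) *\<^sub>R (norm y *\<^sub>R alpha_inv v 1 - 1))"
    by (intro positive_scaleR) (simp_all add: linear_diff[OF lin] linear_scale[OF lin] conj_y)
  then have "positive ((r - 1 / norm y) *\<^sub>R 1 - \<psi> 1)"
    using \<open>y \<noteq> 0\<close> by (simp add: \<psi>_one algebra_simps)
  then have "norm (\<psi> 1) \<le> r - 1 / norm y"
    by (intro norm_le_of_positive_diff positive_mapD[OF \<psi>] positive_one)
  also have "\<dots> < r" using \<open>y \<noteq> 0\<close> by simp
  finally show ?thesis using v(1) by (auto simp: onorm_positive_map[OF \<psi>] simp flip: \<psi>_def)
qed

lemma positive_resolvent_of_positively_solvable:
  assumes \<phi>: "positive_map \<phi>" and s: "s > 0" "positively_solvable \<phi> s"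
  shows "\<exists>K<s. \<forall>r>K. positive_resolvent \<phi> r"
proof -
  obtain v where v: "strictly_positive v" "onorm (alpha_inv v \<circ> \<phi> \<circ> alpha v) < s"
    using similar_onorm_less_of_positively_solvable[OF assms] by blast
  have similar: "elem_similar \<phi> (alpha_inv v \<circ> \<phi> \<circ> alpha v)"
    using v(1) by (intro elem_similar_conj) (simp add: strictly_positive_def)
  have "positive_resolvent \<phi> r" if "onorm (alpha_inv v \<circ> \<phi> \<circ> alpha v) < r" for r
    by (rule positive_resolvent_elem_similar[OF similar
          positive_resolvent_of_onorm_less[OF positive_map_similar[OF \<phi>] that]])
  then show ?thesis using v(2) by blast
qed

lemma positively_solvable_limit:
  fixes \<phi> :: "'a::cstar_algebra \<Rightarrow> 'a"
  assumes \<phi>: "positive_map \<phi>" and bij: "bij (\<lambda>x. \<mu> *\<^sub>R x - \<phi> x)"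
    and f: "\<And>n. \<mu> \<le> f n" "\<And>n. positive_resolvent \<phi> (f n)" "f \<longlonglongrightarrow> \<mu>"
  shows "positively_solvable \<phi> \<mu>"
proof -
  obtain y where y: "\<mu> *\<^sub>R y - \<phi> y = 1"
    using surjD[OF bij_is_surj[OF bij], of 1] by auto
  have "\<mu> *\<^sub>R cstar_adj y - \<phi> (cstar_adj y) = 1"
    using arg_cong[OF y, of cstar_adj] by (simp add: adj_simps positive_map_adj[OF \<phi>])
  with y have "\<mu> *\<^sub>R cstar_adj y - \<phi> (cstar_adj y) = \<mu> *\<^sub>R y - \<phi> y" by simp
  then have self_adj: "self_adj y" by (rule injD[OF bij_is_inj[OF bij]])
  have "(\<lambda>n. (f n - \<mu>) * norm y) \<longlonglongrightarrow> (\<mu> - \<mu>) * norm y"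
    by (intro tendsto_intros f(3))
  then have "\<forall>\<^sub>F n in sequentially. (f n - \<mu>) * norm y < 1" by (rule order_tendstoD) simp
  then obtain n where "(f n - \<mu>) * norm y < 1" by (auto simp: eventually_sequentially)
  then have "norm ((f n - \<mu>) *\<^sub>R y) \<le> 1" using f(1)[of n] by simp
  then have "positive (1 *\<^sub>R 1 + (f n - \<mu>) *\<^sub>R y)"
    using self_adj by (intro positive_add_of_norm_le) (simp add: adj_scaleR)
  also have "1 *\<^sub>R 1 + (f n - \<mu>) *\<^sub>R y = f n *\<^sub>R y - \<phi> y"
    by (simp add: scaleR_diff_left flip: y)
  finally have "positive y" using f(2)[of n] unfolding positive_resolvent_def by blast
  with y show ?thesis by (auto simp: positively_solvable_def)
qed

lemma positively_solvable_of_bij: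
  fixes \<phi> :: "'a::cstar_algebra \<Rightarrow> 'a"
  assumes \<phi>: "positive_map \<phi>" and s: "s \<ge> 0" and bij: "\<And>r. r \<ge> s \<Longrightarrow> bij (\<lambda>x. r *\<^sub>R x - \<phi> x)"
  shows "positively_solvable \<phi> s"
proof (rule real_descent)
  show "s \<le> max s (onorm \<phi> + 1)" by simp
  show "positively_solvable \<phi> (max s (onorm \<phi> + 1))"
    by (intro positively_solvable_of_positive_resolvent positive_resolvent_of_onorm_less \<phi>) simp
next
  fix r assume "s < r" "positively_solvable \<phi> r"
  then obtain K where K: "K < r" "\<And>r'. r' > K \<Longrightarrow> positive_resolvent \<phi> r'"
    using positive_resolvent_of_positively_solvable[OF \<phi>, of r] s by auto
  obtain r' where "max K s < r'" "r' < r" using dense[of "max K s" r] K(1) \<open>s < r\<close> by auto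
  then show "\<exists>r'. s \<le> r' \<and> r' < r \<and> positively_solvable \<phi> r'"
    by (intro exI[of _ r']) (simp add: positively_solvable_of_positive_resolvent K(2))
next
  fix r f assume r: "s \<le> r" and f: "\<And>n. r \<le> f n \<and> positively_solvable \<phi> (f n)" "f \<longlonglongrightarrow> r"
  show "positively_solvable \<phi> r"
  proof (cases "\<exists>n. f n = r")
    case False
    have "positive_resolvent \<phi> (f n)" for n
    proof -
      have "r < f n" using False f(1)[of n] by (metis order_le_less)
      then have "0 < f n" using r s by simp
      then show ?thesis
        using positive_resolvent_of_positively_solvable[OF \<phi>] f(1)[of n] by blast
    qed
    then show ?thesis using f by (intro positively_solvable_limit[OF \<phi> bij[OF r]]) auto
  qed (use f(1) in metis)
qed

section \<open>The spectral radius of a positive map\<close>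

lemma op_spectrum_nonempty:
  assumes \<phi>: "positive_map \<phi>"
  shows "op_spectrum \<phi> \<noteq> {}"
proof
  assume "op_spectrum \<phi> = {}"
  then have "positively_solvable \<phi> 0"
    by (intro positively_solvable_of_bij[OF \<phi>]) (simp_all add: bij_real_resolvent_iff)
  then obtain y where "positive y" "\<phi> y = - 1"
    by (auto simp: positively_solvable_def minus_equation_iff)
  then show False using positive_mapD[OF \<phi>] not_positive_minus_one by metis
qed

lemma positively_solvable_of_spectral_radius_less:
  assumes \<phi>: "positive_map \<phi>" and s: "s > 0" and radius: "spectral_radius \<phi> < s"
  shows "positively_solvable \<phi> s"
proof (rule positively_solvable_of_bij[OF \<phi>])
  fix r assume "s \<le> r"
  have "bdd_above (cmod ` op_spectrum \<phi>)"
    using cmod_op_spectrum_le_onorm[OF positive_map_bounded_linear[OF \<phi>]]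
    by (auto simp: bdd_above_def)
  then have "cmod c \<le> spectral_radius \<phi>" if "c \<in> op_spectrum \<phi>" for c
    unfolding spectral_radius_def using that by (intro cSup_upper) auto
  then show "bij (\<lambda>x. r *\<^sub>R x - \<phi> x)"
    unfolding bij_real_resolvent_iff using radius s \<open>s \<le> r\<close> by fastforce
qed (use s in simp)

lemma spectral_radius_le_onorm_similar:
  assumes \<psi>: "positive_map \<psi>" and sim: "elem_similar \<phi> \<psi>"
  shows "spectral_radius \<phi> \<le> onorm \<psi>"
  unfolding spectral_radius_def op_spectrum_elem_similar[OF sim]
proof (rule cSup_least)
  show "cmod ` op_spectrum \<psi> \<noteq> {}" using op_spectrum_nonempty[OF \<psi>] by simp
qed (use cmod_op_spectrum_le_onorm[OF positive_map_bounded_linear[OF \<psi>]] in auto)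

theorem theorem3p2:
  fixes \<phi> :: "'a::cstar_algebra \<Rightarrow> 'a" and s :: real
  assumes "positive_map \<phi>" and "s > 0"
  shows "(spectral_radius \<phi> < s \<longleftrightarrow> (\<exists>w. positive w \<and> \<phi> w = s *\<^sub>R (w - 1)))
       \<and> (spectral_radius \<phi> < s \<longleftrightarrow>
            (\<exists>v. strictly_positive v \<and> onorm (alpha_inv v \<circ> \<phi> \<circ> alpha v) < s))
       \<and> (spectral_radius \<phi> < s \<longleftrightarrow>
            (\<exists>\<psi>. positive_map \<psi> \<and> elem_similar \<phi> \<psi> \<and> onorm \<psi> < s))"
proof -
  have solvable_iff: "positively_solvable \<phi> s \<longleftrightarrow> (\<exists>w. positive w \<and> \<phi> w = s *\<^sub>R (w - 1))"
    by (rule positively_solvable_iff[OF positive_map_linear[OF assms(1)] assms(2)])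
  have solvable: "positively_solvable \<phi> s" if "spectral_radius \<phi> < s"
    by (rule positively_solvable_of_spectral_radius_less[OF assms that])
  have contraction: "\<exists>v. strictly_positive v \<and> onorm (alpha_inv v \<circ> \<phi> \<circ> alpha v) < s"
    if "positively_solvable \<phi> s"
    by (rule similar_onorm_less_of_positively_solvable[OF assms that])
  have similar: "\<exists>\<psi>. positive_map \<psi> \<and> elem_similar \<phi> \<psi> \<and> onorm \<psi> < s"
    if "strictly_positive v" "onorm (alpha_inv v \<circ> \<phi> \<circ> alpha v) < s" for v
    using positive_map_similar[OF assms(1)] elem_similar_conj that
    unfolding strictly_positive_def by blast
  have radius: "spectral_radius \<phi> < s" if "positive_map \<psi>" "elem_similar \<phi> \<psi>" "onorm \<psi> < s" for \<psi>
    using spectral_radius_le_onorm_similar[OF that(1,2)] that(3) by simp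
  show ?thesis
    unfolding solvable_iff[symmetric] using solvable contraction similar radius by meson
qed

end
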